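(* Let $(\Omega,\mathscr{F})$ be a measurable space, $\alpha$ a finite measure on it with $a=\alpha(\Omega)>0$, and $f_1,\ldots,f_d:\Omega\to\mathbb{R}$ measurable functions with $\int_\Omega\log(1+|f_k|)\,d\alpha<+\infty$ for $k=1,\ldots,d$. Assume that $\mathbf f=(f_1,\ldots,f_d)$ is not affinely $\alpha$-degenerate. Let $\tilde m$ be a random probability measure on $(\Omega,\mathscr{F})$ with distribution $\mathscr{D}_\alpha$. Then the probability distribution $\mu_{\alpha,\mathbf f}$ of $(\tilde m(f_1),\ldots,\tilde m(f_d))$, where $\tilde m(f_k)=\int_\Omega f_k\,d\tilde m$, is absolutely continuous with respect to the Lebesgue measure on $\mathbb{R}^d$.
   Context: $\mathbf f$ is affinely $\alpha$-degenerate if there are $\mathbf v\in\mathbb{R}^d\setminus\{0\}$ and $b\in\mathbb{R}$ such that $\alpha\{\langle\mathbf v,\mathbf f\rangle=b\}=a$, where $\langle\mathbf v,\mathbf f\rangle=\sum_{j=1}^dv_jf_j$. $\tilde m$ has the functional Dirichlet distribution $\mathscr{D}_\alpha$ if, for every finite measurable partition $C_1,\ldots,C_{n+1}$ of $\Omega$, $(\tilde m(C_1),\ldots,\tilde m(C_n))$ has the Dirichlet distribution with parameter $(\alpha(C_1),\ldots,\alpha(C_{n+1}))$ (components with $\alpha(C_i)=0$ being a.s. $0$). Under the log-integrability condition the $\tilde m(f_k)$ are a.s. well defined and finite. *)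

theory Defs
  imports "HOL-Probability.Probability"
begin

text \<open>
  The Dirichlet density on the open simplex of \<open>\<real>\<^bsup>J\<^esup>\<close> with parameters \<open>p i\<close>, \<open>i \<in> insert k J\<close>; the
  component with index \<open>k \<notin> J\<close> is the dependent one, equal to one minus the sum of the others.
\<close>
definition dirichlet_density :: "nat set \<Rightarrow> nat \<Rightarrow> (nat \<Rightarrow> real) \<Rightarrow> (nat \<Rightarrow> real) \<Rightarrow> real" where
  "dirichlet_density J k p x =
     (if (\<forall>i\<in>J. 0 < x i) \<and> (\<Sum>i\<in>J. x i) < 1
      then Gamma (\<Sum>i\<in>insert k J. p i) / (\<Prod>i\<in>insert k J. Gamma (p i))
             * (\<Prod>i\<in>J. x i powr (p i - 1)) * (1 - (\<Sum>i\<in>J. x i)) powr (p k - 1)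
      else 0)"

text \<open>
  The Dirichlet distribution with parameter \<open>(p 0, \<dots>, p n)\<close> (nonnegative, not all zero), as the law
  of the first \<open>n\<close> components.  Components with parameter zero are identically zero, and those with
  positive parameter jointly have the usual Dirichlet distribution.  The last index with positive
  parameter is taken as the dependent one, so that when all parameters are positive this is the
  measure with the Dirichlet density on \<open>\<real>\<^sup>n\<close> (see \<open>dirichlet_distr_pos\<close> below).
\<close>
definition dirichlet_distr :: "nat \<Rightarrow> (nat \<Rightarrow> real) \<Rightarrow> (nat \<Rightarrow> real) measure" where
  "dirichlet_distr n p =
     (let I = {i\<in>{..n}. 0 < p i}; k = Max I; J = I - {k}
      in distr (density (Pi\<^sub>M J (\<lambda>_. lborel)) (\<lambda>x. ennreal (dirichlet_density J k p x)))
           (Pi\<^sub>M {..<n} (\<lambda>_. borel))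
           (\<lambda>x. \<lambda>i\<in>{..<n}. if i \<in> J then x i else if i = k then 1 - (\<Sum>j\<in>J. x j) else 0))"

lemma dirichlet_distr_pos:
  assumes "\<And>i. i \<le> n \<Longrightarrow> 0 < p i"
  shows "dirichlet_distr n p =
    density (Pi\<^sub>M {..<n} (\<lambda>_. lborel)) (\<lambda>x. ennreal (dirichlet_density {..<n} n p x))"
proof -
  let ?D = "density (Pi\<^sub>M {..<n} (\<lambda>_. lborel)) (\<lambda>x. ennreal (dirichlet_density {..<n} n p x))"
  have I: "{i\<in>{..n}. 0 < p i} = {..n}"
    using assms by auto
  have M: "Max {..n} = n"
    by (rule Max_eqI) auto
  have J: "{..n} - {n} = {..<n}"
    by auto
  have S: "sets (Pi\<^sub>M {..<n} (\<lambda>_. borel)) = sets ?D"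
    by (auto intro!: sets_PiM_cong)
  have "dirichlet_distr n p = distr ?D (Pi\<^sub>M {..<n} (\<lambda>_. borel))
      (\<lambda>x. \<lambda>i\<in>{..<n}. if i \<in> {..<n} then x i else if i = n then 1 - (\<Sum>j\<in>{..<n}. x j) else 0)"
    unfolding dirichlet_distr_def Let_def I M J ..
  also have "\<dots> = distr ?D ?D (\<lambda>x. x)"
    by (rule distr_cong) (auto simp: S space_PiM PiE_def extensional_def restrict_def)
  also have "\<dots> = ?D"
    by (rule distr_id)
  finally show ?thesis .
qed

text \<open>
  The random probability measure \<open>m\<close>, defined on the probability space \<open>P\<close>, has the functional
  Dirichlet distribution with parameter \<open>\<alpha>\<close>.  The space \<open>prob_algebra \<alpha>\<close> depends on \<open>\<alpha>\<close> only
  through its underlying measurable space.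
\<close>
definition functional_dirichlet :: "'w measure \<Rightarrow> 'a measure \<Rightarrow> ('w \<Rightarrow> 'a measure) \<Rightarrow> bool" where
  "functional_dirichlet P \<alpha> m \<longleftrightarrow>
     m \<in> measurable P (prob_algebra \<alpha>) \<and>
     (\<forall>(n::nat) (C :: nat \<Rightarrow> 'a set).
        (\<forall>i\<le>n. C i \<in> sets \<alpha>) \<and> disjoint_family_on C {..n} \<and> (\<Union>i\<le>n. C i) = space \<alpha> \<longrightarrow>
        distr P (Pi\<^sub>M {..<n} (\<lambda>_. borel)) (\<lambda>\<omega>. \<lambda>i\<in>{..<n}. measure (m \<omega>) (C i)) =
          dirichlet_distr n (\<lambda>i. measure \<alpha> (C i)))"

definition affinely_degenerate :: "'a measure \<Rightarrow> ('d::finite \<Rightarrow> 'a \<Rightarrow> real) \<Rightarrow> bool" where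
  "affinely_degenerate \<alpha> f \<longleftrightarrow>
     (\<exists>(v :: real ^ 'd) (b :: real). v \<noteq> 0 \<and>
        measure \<alpha> {x \<in> space \<alpha>. (\<Sum>j\<in>UNIV. v $ j * f j x) = b} = measure \<alpha> (space \<alpha>))"

text \<open>
  The law of the vector of means.  Where \<open>f k\<close> is not integrable with respect to \<open>m \<omega>\<close>, the Bochner
  integral takes the conventional value \<open>0\<close>; by \<open>measurable_mean\<close> the map is measurable everywhere.
\<close>
definition mean_distr :: "'w measure \<Rightarrow> ('w \<Rightarrow> 'a measure) \<Rightarrow> ('d::finite \<Rightarrow> 'a \<Rightarrow> real) \<Rightarrow> (real ^ 'd) measure" where
  "mean_distr P m f = distr P borel (\<lambda>\<omega>. \<chi> k. \<integral>x. f k x \<partial>(m \<omega>))"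

lemma measurable_mean:
  fixes f :: "'d::finite \<Rightarrow> 'a \<Rightarrow> real"
  assumes f: "\<And>k. f k \<in> borel_measurable \<alpha>" and m: "m \<in> measurable P (prob_algebra \<alpha>)"
  shows "(\<lambda>\<omega>. \<chi> k. \<integral>x. f k x \<partial>(m \<omega>)) \<in> borel_measurable P"
proof -
  have comp: "(\<lambda>\<omega>. \<integral>x. f k x \<partial>(m \<omega>)) \<in> borel_measurable P" for k
  proof -
    have m': "m \<in> measurable P (subprob_algebra \<alpha>)"
      using m by (rule measurable_prob_algebraD)
    have fm: "f k \<in> borel_measurable (m \<omega>)" if "\<omega> \<in> space P" for \<omega>
      using sets_kernel[OF m' that] f[of k] by (simp cong: measurable_cong_sets)
    have nn: "(\<lambda>\<omega>. \<integral>\<^sup>+x. g x \<partial>(m \<omega>)) \<in> borel_measurable P" if "g \<in> borel_measurable \<alpha>" for g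
      using measurable_compose[OF m' nn_integral_measurable_subprob_algebra[OF that]] .
    have 1: "(\<lambda>\<omega>. \<integral>\<^sup>+x. ennreal (f k x) \<partial>(m \<omega>)) \<in> borel_measurable P"
      and 2: "(\<lambda>\<omega>. \<integral>\<^sup>+x. ennreal (- f k x) \<partial>(m \<omega>)) \<in> borel_measurable P"
      and 3: "(\<lambda>\<omega>. \<integral>\<^sup>+x. ennreal \<bar>f k x\<bar> \<partial>(m \<omega>)) \<in> borel_measurable P"
      using f[of k] by (auto intro!: nn)
    have "(\<lambda>\<omega>. if (\<integral>\<^sup>+x. ennreal \<bar>f k x\<bar> \<partial>(m \<omega>)) < \<infinity>
        then enn2real (\<integral>\<^sup>+x. ennreal (f k x) \<partial>(m \<omega>)) - enn2real (\<integral>\<^sup>+x. ennreal (- f k x) \<partial>(m \<omega>))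
        else 0) \<in> borel_measurable P"
      using 1 2 3 by measurable
    also have "?this \<longleftrightarrow> (\<lambda>\<omega>. \<integral>x. f k x \<partial>(m \<omega>)) \<in> borel_measurable P"
    proof (rule measurable_cong)
      fix \<omega> assume w: "\<omega> \<in> space P"
      have "integrable (m \<omega>) (f k) \<longleftrightarrow> (\<integral>\<^sup>+x. ennreal \<bar>f k x\<bar> \<partial>(m \<omega>)) < \<infinity>"
        using fm[OF w] by (simp add: integrable_iff_bounded)
      then show "(if (\<integral>\<^sup>+x. ennreal \<bar>f k x\<bar> \<partial>(m \<omega>)) < \<infinity>
        then enn2real (\<integral>\<^sup>+x. ennreal (f k x) \<partial>(m \<omega>)) - enn2real (\<integral>\<^sup>+x. ennreal (- f k x) \<partial>(m \<omega>))
        else 0) = (\<integral>x. f k x \<partial>(m \<omega>))"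
        by (cases "integrable (m \<omega>) (f k)")
           (auto simp: real_lebesgue_integral_def not_integrable_integral_eq)
    qed
    finally show ?thesis .
  qed
  show ?thesis
    by (rule borel_measurable_euclidean_space[THEN iffD2])
       (auto simp: Basis_vec_def inner_axis intro!: comp)
qed

end

theory Submission imports Defs begin

text \<open>
  The idea is to perturb the random measure \<open>m\<close> by a density that is constant on finitely many sets,
  and to let the constants range over an open set.  Write \<open>a\<close> for the total mass of \<open>\<alpha>\<close>.

  For a positive simple function \<open>c\<close>, replace \<open>m\<close> by the normalised measure \<open>c \<cdot> m / m(c)\<close>.  The law of a
  Dirichlet random measure is quasi-invariant under this operation: weighted by \<open>m(c)\<close> to the power \<open>-a\<close>,
  the law of the new measure is the old law times the constant \<open>exp (- \<integral> ln c d\<alpha>)\<close>.  On a finite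
  partition this is an identity between Dirichlet integrals (\<open>dirichlet_distr_quasi_invariant\<close>): the density
  \<open>\<Prod> y\<^sub>i powr (p\<^sub>i - 1)\<close> on the positive orthant is homogeneous, the Dirichlet distribution is its radial
  projection to the simplex, and rescaling the coordinates multiplies this density by a constant.
  Approximation by simple functions then gives the identity for the vector of means
  (\<open>quasi_invariant_closed\<close>).

  The total masses in this identity also give the two facts about \<open>m\<close> that are needed along the way.
  With \<open>c = 1 + t * |f|\<close> and \<open>t\<close> tending to \<open>0\<close> it shows that a log-integrable \<open>f\<close> is almost surely
  integrable for \<open>m\<close> (\<open>AE_integrable_m\<close>); with \<open>c = 1 + t\<close> on a set \<open>A\<close> and \<open>t\<close> tending to infinity it
  shows that \<open>m(A)\<close> is almost surely positive when \<open>\<alpha>(A)\<close> is (\<open>AE_m_pos\<close>).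

  Let \<open>F = (f, 1)\<close>, with values in \<open>\<real>\<^sup>d \<times> \<real>\<close>.  If \<open>f\<close> is not affinely degenerate then the support of the
  image of \<open>\<alpha>\<close> under \<open>F\<close> spans the whole space, so it contains a basis, and balls around the basis vectors
  can be taken so small that any choice of one vector per ball is again a basis
  (\<open>stable_frame_in_support\<close>).  Let \<open>A\<^sub>b\<close> be the preimages of these balls and let \<open>c\<^sub>u\<close> be \<open>u\<^sub>b\<close> on \<open>A\<^sub>b\<close> and
  \<open>1\<close> elsewhere.  For almost every fixed \<open>m\<close> the vector \<open>(m(c\<^sub>u f), m(c\<^sub>u))\<close> is an injective affine function
  of \<open>u\<close>, because the averages of \<open>F\<close> over the \<open>A\<^sub>b\<close> lie in the balls.  Hence its quotient
  \<open>m(c\<^sub>u f) / m(c\<^sub>u)\<close> lies in a given Lebesgue null set \<open>S\<close>, closed by inner regularity, for almost no \<open>u\<close>.  By Fubini there is one \<open>u\<close>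
  for which this quotient is almost surely outside \<open>S\<close>, and quasi-invariance transfers this to the
  vector of means itself (\<open>AE_mean_notin_closed_null\<close>).
\<close>

section \<open>The cone over the simplex\<close>

lemma nn_integral_PiM_lborel_scale:
  fixes c :: "'i \<Rightarrow> real"
  assumes "finite I" "\<And>i. i \<in> I \<Longrightarrow> 0 < c i" "F \<in> borel_measurable (Pi\<^sub>M I (\<lambda>_. lborel))"
  shows "(\<integral>\<^sup>+y. F y \<partial>Pi\<^sub>M I (\<lambda>_. lborel)) =
    ennreal (\<Prod>i\<in>I. c i) * (\<integral>\<^sup>+y. F (\<lambda>i\<in>I. c i * y i) \<partial>Pi\<^sub>M I (\<lambda>_. lborel))"
  using assms
proof (induction I arbitrary: F rule: finite_induct)
  case empty
  interpret product_sigma_finite "\<lambda>_::'i. lborel :: real measure" ..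
  show ?case by (simp add: PiM_empty nn_integral_count_space_finite)
next
  case (insert i I)
  interpret product_sigma_finite "\<lambda>_::'i. lborel :: real measure" ..
  note F[measurable] = insert.prems(2)
  have ci: "0 < c i" using insert.prems by auto
  have [measurable]: "(\<lambda>(x, y). x(i := y)) \<in> measurable (Pi\<^sub>M I (\<lambda>_. lborel) \<Otimes>\<^sub>M lborel) (Pi\<^sub>M (insert i I) (\<lambda>_. lborel :: real measure))"
    by (rule measurable_add_dim)
  have [measurable]: "(\<lambda>(x, y). F (x(i := y))) \<in> borel_measurable (Pi\<^sub>M I (\<lambda>_. lborel) \<Otimes>\<^sub>M lborel)"
    using measurable_compose[OF measurable_add_dim F] by (simp add: case_prod_beta)
  have slice: "(\<lambda>t. F (x(i := t))) \<in> borel_measurable borel"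
    if "x \<in> space (Pi\<^sub>M I (\<lambda>_. lborel))" for x
    using measurable_compose[OF measurable_Pair1'[OF that] \<open>(\<lambda>(x, y). F (x(i := y))) \<in> _\<close>]
    by simp
  have M: "(\<lambda>(x,t). F (x(i := c i * t))) \<in> borel_measurable (Pi\<^sub>M I (\<lambda>_. lborel) \<Otimes>\<^sub>M lborel)"
  proof -
    have "(\<lambda>(x,t). (x, c i * t)) \<in> measurable (Pi\<^sub>M I (\<lambda>_. lborel) \<Otimes>\<^sub>M lborel) (Pi\<^sub>M I (\<lambda>_. lborel) \<Otimes>\<^sub>M (lborel :: real measure))"
      by measurable
    from measurable_compose[OF this \<open>(\<lambda>(x, y). F (x(i := y))) \<in> _\<close>]
    show ?thesis by (simp add: case_prod_beta)
  qed
  have M': "(\<lambda>x. \<integral>\<^sup>+t. F (x(i := c i * t)) \<partial>lborel) \<in> borel_measurable (Pi\<^sub>M I (\<lambda>_. lborel))"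
    using lborel.borel_measurable_nn_integral[OF M] .
  have "(\<integral>\<^sup>+y. F y \<partial>Pi\<^sub>M (insert i I) (\<lambda>_. lborel)) =
      (\<integral>\<^sup>+x. \<integral>\<^sup>+t. F (x(i := t)) \<partial>lborel \<partial>Pi\<^sub>M I (\<lambda>_. lborel))"
    using insert by (subst product_nn_integral_insert) auto
  also have "\<dots> = (\<integral>\<^sup>+x. ennreal (c i) * (\<integral>\<^sup>+t. F (x(i := c i * t)) \<partial>lborel) \<partial>Pi\<^sub>M I (\<lambda>_. lborel))"
    using ci by (intro nn_integral_cong, subst nn_integral_real_affine[where t=0 and c="c i"])
      (auto intro!: slice)
  also have "\<dots> = ennreal (c i) * (\<integral>\<^sup>+x. (\<integral>\<^sup>+t. F (x(i := c i * t)) \<partial>lborel) \<partial>Pi\<^sub>M I (\<lambda>_. lborel))"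
    by (rule nn_integral_cmult[OF M'])
  also have "\<dots> = ennreal (c i) * (ennreal (\<Prod>i\<in>I. c i) *
      (\<integral>\<^sup>+x. (\<integral>\<^sup>+t. F ((\<lambda>j\<in>I. c j * x j)(i := c i * t)) \<partial>lborel) \<partial>Pi\<^sub>M I (\<lambda>_. lborel)))"
    using insert.prems by (subst insert.IH[OF _ M']) auto
  also have "\<dots> = ennreal (\<Prod>i\<in>insert i I. c i) *
      (\<integral>\<^sup>+x. (\<integral>\<^sup>+t. F ((\<lambda>j\<in>I. c j * x j)(i := c i * t)) \<partial>lborel) \<partial>Pi\<^sub>M I (\<lambda>_. lborel))"
    using insert.hyps by (simp add: ennreal_mult'[OF less_imp_le[OF ci]] mult.assoc)
  also have "(\<integral>\<^sup>+x. (\<integral>\<^sup>+t. F ((\<lambda>j\<in>I. c j * x j)(i := c i * t)) \<partial>lborel) \<partial>Pi\<^sub>M I (\<lambda>_. lborel)) =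
     (\<integral>\<^sup>+x. (\<integral>\<^sup>+t. F (\<lambda>j\<in>insert i I. c j * (x(i := t)) j) \<partial>lborel) \<partial>Pi\<^sub>M I (\<lambda>_. lborel))"
    using insert.hyps by (intro nn_integral_cong arg_cong[where f=F]) (auto simp: fun_eq_iff)
  also have "\<dots> = (\<integral>\<^sup>+y. F (\<lambda>j\<in>insert i I. c j * y j) \<partial>Pi\<^sub>M (insert i I) (\<lambda>_. lborel))"
  proof (rule product_nn_integral_insert[symmetric])
    have "(\<lambda>y. \<lambda>j\<in>insert i I. c j * y j) \<in> measurable (Pi\<^sub>M (insert i I) (\<lambda>_. lborel)) (Pi\<^sub>M (insert i I) (\<lambda>_. lborel :: real measure))"
      by (intro measurable_restrict) (auto simp del: fun_upd_apply)
    from measurable_compose[OF this F]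
    show "(\<lambda>y. F (\<lambda>j\<in>insert i I. c j * y j)) \<in> borel_measurable (Pi\<^sub>M (insert i I) (\<lambda>_. lborel))" .
  qed (use insert in auto)
  finally show ?case .
qed

text \<open>
  The homogeneous density on the positive orthant whose radial projection to the simplex is, up to a
  constant, the Dirichlet density with parameters \<open>p 0, \<dots>, p n\<close>.
\<close>
definition power_weight :: "nat \<Rightarrow> (nat \<Rightarrow> real) \<Rightarrow> (nat \<Rightarrow> real) \<Rightarrow> real" where
  "power_weight n p y = (\<Prod>i\<le>n. indicator {0<..} (y i) * y i powr (p i - 1))"

lemma power_weight_measurable [measurable]:
  "power_weight n p \<in> borel_measurable (Pi\<^sub>M {..n} (\<lambda>_. borel))"
  unfolding power_weight_def by measurable

lemma power_weight_scale:
  assumes "\<And>i. i \<le> n \<Longrightarrow> 0 < c i"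
  shows "power_weight n p (\<lambda>i\<in>{..n}. c i * y i) = (\<Prod>i\<le>n. c i powr (p i - 1)) * power_weight n p y"
  unfolding power_weight_def prod.distrib[symmetric]
proof (rule prod.cong)
  fix i assume "i \<in> {..n}"
  then show "indicator {0<..} ((\<lambda>i\<in>{..n}. c i * y i) i) * (\<lambda>i\<in>{..n}. c i * y i) i powr (p i - 1) =
    c i powr (p i - 1) * (indicator {0<..} (y i) * y i powr (p i - 1))"
    using assms[of i] by (auto simp: indicator_def zero_less_mult_iff powr_mult)
qed simp

text \<open>
  The Dirichlet distribution lives on the first \<open>n\<close> barycentric coordinates of a point of the simplex;
  this recovers all \<open>n + 1\<close> of them.
\<close>
definition full_coords :: "nat \<Rightarrow> (nat \<Rightarrow> real) \<Rightarrow> nat \<Rightarrow> real" where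
  "full_coords n x i = (if i < n then x i else 1 - (\<Sum>j<n. x j))"

lemma full_coords_simps [simp]:
  "i < n \<Longrightarrow> full_coords n x i = x i" "full_coords n x n = 1 - (\<Sum>j<n. x j)"
  by (auto simp: full_coords_def)

lemma full_coords_measurable [measurable]:
  assumes "i \<le> n"
  shows "(\<lambda>x. full_coords n x i) \<in> borel_measurable (Pi\<^sub>M {..<n} (\<lambda>_. borel))"
  using assms by (cases "i = n") auto

text \<open>
  In polar coordinates \<open>y = s x\<close>, with \<open>x\<close> in the simplex, the Jacobian is \<open>s ^ n\<close>; with it, homogeneity
  splits the weight into a power of \<open>s\<close> and the Dirichlet density.
\<close>
lemma power_weight_cone:
  fixes p x :: "nat \<Rightarrow> real" and s :: real and n :: nat
  defines "a \<equiv> \<Sum>i\<le>n. p i"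
  assumes p: "\<And>i. i \<le> n \<Longrightarrow> 0 < p i" and s: "0 < s"
  shows "s ^ n * power_weight n p (\<lambda>i\<in>{..n}. s * full_coords n x i) =
    s powr (a - 1) * ((\<Prod>i\<le>n. Gamma (p i)) / Gamma a * dirichlet_density {..<n} n p x)"
proof -
  let ?t = "1 - (\<Sum>i<n. x i)"
  have split: "{..n} = insert n {..<n}" by auto
  have a: "a = p n + (\<Sum>i<n. p i)" by (simp add: a_def split)
  have a0: "0 < a" unfolding a_def using p by (intro sum_pos) auto
  have G: "(\<Prod>i\<le>n. Gamma (p i)) \<noteq> 0" "Gamma a \<noteq> 0"
    using p a0 by (auto simp: Gamma_eq_zero_iff nonpos_Ints_def less_le_not_le dest!: p)
  let ?I = "\<lambda>t::real. indicator {0<..} t :: real"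
  let ?A = "?I ?t * ?t powr (p n - 1) * (\<Prod>i<n. ?I (x i) * x i powr (p i - 1))"
  have last: "?I (s * ?t) * (s * ?t) powr (p n - 1) = s powr (p n - 1) * (?I ?t * ?t powr (p n - 1))"
    using s by (auto simp: indicator_def zero_less_mult_iff powr_mult)
  have "(\<Prod>i<n. ?I (s * x i) * (s * x i) powr (p i - 1)) =
      (\<Prod>i<n. s powr (p i - 1)) * (\<Prod>i<n. ?I (x i) * x i powr (p i - 1))"
    unfolding prod.distrib[symmetric] using s
    by (intro prod.cong) (auto simp: indicator_def zero_less_mult_iff powr_mult)
  also have "(\<Prod>i<n. s powr (p i - 1)) = s powr (\<Sum>i<n. p i - 1)"
    using s by (simp add: powr_sum)
  finally have rest: "(\<Prod>i<n. ?I (s * x i) * (s * x i) powr (p i - 1)) =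
      s powr (\<Sum>i<n. p i - 1) * (\<Prod>i<n. ?I (x i) * x i powr (p i - 1))" .
  have W: "power_weight n p (\<lambda>i\<in>{..n}. s * full_coords n x i) =
    (?I (s * ?t) * (s * ?t) powr (p n - 1)) * (\<Prod>i<n. ?I (s * x i) * (s * x i) powr (p i - 1))"
    unfolding power_weight_def split by simp
  have "real n + (p n - 1) + (\<Sum>i<n. p i - 1) = a - 1"
    unfolding a by (simp add: sum_subtractf)
  then have S: "s powr n * s powr (p n - 1) * s powr (\<Sum>i<n. p i - 1) = s powr (a - 1)"
    by (simp only: powr_add[symmetric])
  have A: "?A = (\<Prod>i\<le>n. Gamma (p i)) / Gamma a * dirichlet_density {..<n} n p x"
  proof (cases "(\<forall>i<n. 0 < x i) \<and> (\<Sum>i<n. x i) < 1")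
    case True
    then show ?thesis
      using G unfolding dirichlet_density_def split[symmetric] a_def[symmetric] by (simp add: mult_ac)
  next
    case False
    then have "?t \<le> 0 \<or> (\<exists>i<n. x i \<le> 0)" by (auto simp: not_less)
    then have "indicator {0<..} ?t * ?t powr (p n - 1) * (\<Prod>i<n. indicator {0<..} (x i) * x i powr (p i - 1)) = 0"
      by (force simp: indicator_def prod_zero_iff)
    moreover have "dirichlet_density {..<n} n p x = 0"
      using False by (auto simp: dirichlet_density_def)
    ultimately show ?thesis by simp
  qed
  have "s ^ n * power_weight n p (\<lambda>i\<in>{..n}. s * full_coords n x i) =
      (s powr n * s powr (p n - 1) * s powr (\<Sum>i<n. p i - 1)) * ?A"
    unfolding W last rest powr_realpow[OF s] by (simp only: mult_ac)
  then show ?thesis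
    unfolding S A .
qed

lemma power_weight_nonpos:
  assumes "s \<le> 0"
  shows "power_weight n p (x(n := s - (\<Sum>i<n. x i))) = 0"
proof (rule ccontr)
  assume "power_weight n p (x(n := s - (\<Sum>i<n. x i))) \<noteq> 0"
  then have pos: "0 < (x(n := s - (\<Sum>i<n. x i))) i" if "i \<le> n" for i
    using that unfolding power_weight_def by (force simp: prod_zero_iff indicator_def split: if_splits)
  have "0 \<le> x i" if "i < n" for i using pos[of i] that by simp
  then have "0 \<le> (\<Sum>i<n. x i)" by (intro sum_nonneg) simp
  with pos[of n] assms show False by simp
qed

text \<open>
  Integration in polar coordinates over the cone.  The change of variables needs no determinant: the
  last coordinate is translated by the sum of the others, which makes it the total \<open>s\<close>, and for fixed \<open>s\<close>
  the others are scaled by \<open>s\<close>.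
\<close>
lemma nn_integral_power_weight:
  fixes p :: "nat \<Rightarrow> real" and n :: nat
  defines "a \<equiv> \<Sum>i\<le>n. p i"
  assumes p: "\<And>i. i \<le> n \<Longrightarrow> 0 < p i"
    and H [measurable]: "H \<in> borel_measurable (Pi\<^sub>M {..n} (\<lambda>_. borel))"
  shows "(\<integral>\<^sup>+y. ennreal (power_weight n p y) * H y \<partial>Pi\<^sub>M {..n} (\<lambda>_. lborel)) =
    ennreal ((\<Prod>i\<le>n. Gamma (p i)) / Gamma a) *
    (\<integral>\<^sup>+x. \<integral>\<^sup>+s. ennreal (indicator {0<..} s * s powr (a - 1)) *
        H (\<lambda>i\<in>{..n}. s * full_coords n x i) \<partial>lborel \<partial>dirichlet_distr n p)"
proof -
  interpret product_sigma_finite "\<lambda>_::nat. lborel :: real measure" ..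
  let ?L = "Pi\<^sub>M {..<n} (\<lambda>_. lborel :: real measure)"
  interpret L: sigma_finite_measure ?L by (rule sigma_finite) simp
  interpret P: pair_sigma_finite ?L "lborel :: real measure" ..
  define K where "K = (\<Prod>i\<le>n. Gamma (p i)) / Gamma a"
  define F where "F y = ennreal (power_weight n p y) * H y" for y
  have split: "{..n} = insert n {..<n}" by auto
  have setsL [measurable_cong]: "sets ?L = sets (Pi\<^sub>M {..<n} (\<lambda>_. borel))"
    by (rule sets_PiM_cong) auto
  have a0: "0 < a" unfolding a_def using p by (intro sum_pos) auto
  have K0: "0 \<le> K" unfolding K_def using p a0
    by (intro divide_nonneg_nonneg prod_nonneg) (auto intro: less_imp_le Gamma_real_pos)
  have F [measurable]: "F \<in> borel_measurable (Pi\<^sub>M {..n} (\<lambda>_. borel))"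
    unfolding F_def by measurable
  have F': "F \<in> borel_measurable (Pi\<^sub>M (insert n {..<n}) (\<lambda>_. lborel))"
  proof -
    have "sets (Pi\<^sub>M {..n} (\<lambda>_. borel)) = sets (Pi\<^sub>M {..n} (\<lambda>_. lborel :: real measure))"
      by (rule sets_PiM_cong) auto
    from measurable_cong_sets[OF this refl] F show ?thesis unfolding split[symmetric] by blast
  qed
  have upd [measurable]: "(\<lambda>z. (u z)(n := v z)) \<in> measurable M (Pi\<^sub>M {..n} (\<lambda>_. borel))"
    if "u \<in> measurable M (Pi\<^sub>M {..<n} (\<lambda>_. borel))" "v \<in> measurable M (borel :: real measure)"
    for M :: "'m measure" and u v
    unfolding split using that by (intro measurable_fun_upd[where J="{..<n}"]) auto
  have G [measurable]: "(\<lambda>(x, s). F (x(n := s - (\<Sum>i<n. x i)))) \<in> borel_measurable (?L \<Otimes>\<^sub>M lborel)"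
    by measurable
  have dens [measurable]: "dirichlet_density {..<n} n p \<in> borel_measurable ?L"
    unfolding dirichlet_density_def split[symmetric] by measurable
  have dens0: "0 \<le> dirichlet_density {..<n} n p x" for x
    unfolding dirichlet_density_def split[symmetric] a_def[symmetric]
    using p a0 by (auto intro!: mult_nonneg_nonneg divide_nonneg_nonneg prod_nonneg less_imp_le[OF Gamma_real_pos])
  have D: "dirichlet_distr n p = density ?L (\<lambda>x. ennreal (dirichlet_density {..<n} n p x))"
    by (rule dirichlet_distr_pos) (rule p)
  have "(\<integral>\<^sup>+y. F y \<partial>Pi\<^sub>M {..n} (\<lambda>_. lborel)) = (\<integral>\<^sup>+x. \<integral>\<^sup>+t. F (x(n := t)) \<partial>lborel \<partial>?L)"
    unfolding split using F' by (subst product_nn_integral_insert) auto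
  (* Translation of the last coordinate: s is the sum of all coordinates. *)
  also have "\<dots> = (\<integral>\<^sup>+x. \<integral>\<^sup>+s. F (x(n := s - (\<Sum>i<n. x i))) \<partial>lborel \<partial>?L)"
  proof (rule nn_integral_cong)
    fix x assume x: "x \<in> space ?L"
    then have x': "x \<in> space (Pi\<^sub>M {..<n} (\<lambda>_. borel :: real measure))" by (simp add: space_PiM)
    have [measurable]: "(\<lambda>t. F (x(n := t))) \<in> borel_measurable borel"
      using x' by measurable
    show "(\<integral>\<^sup>+t. F (x(n := t)) \<partial>lborel) = (\<integral>\<^sup>+s. F (x(n := s - (\<Sum>i<n. x i))) \<partial>lborel)"
      by (subst nn_integral_real_affine[where t="- (\<Sum>i<n. x i)" and c=1]) auto
  qed
  also have "\<dots> = (\<integral>\<^sup>+s. \<integral>\<^sup>+x. F (x(n := s - (\<Sum>i<n. x i))) \<partial>?L \<partial>lborel)"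
    by (rule P.Fubini'[symmetric, OF G])
  also have "\<dots> = (\<integral>\<^sup>+s. \<integral>\<^sup>+x. ennreal (indicator {0<..} s * s powr (a - 1)) *
      (ennreal (K * dirichlet_density {..<n} n p x) *
        H (\<lambda>i\<in>{..n}. s * full_coords n x i)) \<partial>?L \<partial>lborel)"
  proof (rule nn_integral_cong)
    fix s :: real
    show "(\<integral>\<^sup>+x. F (x(n := s - (\<Sum>i<n. x i))) \<partial>?L) =
      (\<integral>\<^sup>+x. ennreal (indicator {0<..} s * s powr (a - 1)) *
      (ennreal (K * dirichlet_density {..<n} n p x) *
        H (\<lambda>i\<in>{..n}. s * full_coords n x i)) \<partial>?L)"
    proof (cases "0 < s")
      case False
      then show ?thesis by (simp add: F_def power_weight_nonpos)
    next
      case True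
      let ?y = "\<lambda>x. \<lambda>i\<in>{..n}. s * full_coords n x i"
      have [measurable]: "(\<lambda>x. F (x(n := s - (\<Sum>i<n. x i)))) \<in> borel_measurable ?L"
        by measurable
      (* Scaling of the remaining coordinates by s. *)
      have "(\<integral>\<^sup>+x. F (x(n := s - (\<Sum>i<n. x i))) \<partial>?L) =
          ennreal (\<Prod>i<n. s) * (\<integral>\<^sup>+x. F ((\<lambda>i\<in>{..<n}. s * x i)(n := s - (\<Sum>i<n. (\<lambda>i\<in>{..<n}. s * x i) i))) \<partial>?L)"
        using True by (rule_tac nn_integral_PiM_lborel_scale[where c="\<lambda>_. s"]) (simp_all, measurable)
      also have "\<dots> = ennreal (s ^ n) * (\<integral>\<^sup>+x. F (?y x) \<partial>?L)"
        by (intro arg_cong2[where f="(*)"] nn_integral_cong arg_cong[where f=F])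
          (auto simp: fun_eq_iff right_diff_distrib sum_distrib_left restrict_def)
      also have "\<dots> = (\<integral>\<^sup>+x. ennreal (s ^ n) * F (?y x) \<partial>?L)"
        by (subst nn_integral_cmult, measurable)
      also have "\<dots> = (\<integral>\<^sup>+x. ennreal (s powr (a - 1)) *
          (ennreal (K * dirichlet_density {..<n} n p x) * H (?y x)) \<partial>?L)"
      proof (rule nn_integral_cong)
        fix x
        have "ennreal (s ^ n) * F (?y x) = ennreal (s ^ n * power_weight n p (?y x)) * H (?y x)"
          using True unfolding F_def by (subst ennreal_mult') (simp_all only: mult.assoc zero_le_power less_imp_le)
        also have "s ^ n * power_weight n p (?y x) = s powr (a - 1) * (K * dirichlet_density {..<n} n p x)"
          unfolding K_def a_def by (rule power_weight_cone[OF p True])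
        finally show "ennreal (s ^ n) * F (?y x) = ennreal (s powr (a - 1)) *
          (ennreal (K * dirichlet_density {..<n} n p x) * H (?y x))"
          by (simp only: ennreal_mult'[OF powr_ge_zero] mult.assoc)
      qed
      moreover have "indicator {0<..} s * s powr (a - 1) = s powr (a - 1)" using True by simp
      ultimately show ?thesis by (simp only:)
    qed
  qed
  also have "\<dots> = (\<integral>\<^sup>+x. \<integral>\<^sup>+s. ennreal (indicator {0<..} s * s powr (a - 1)) *
      (ennreal (K * dirichlet_density {..<n} n p x) *
        H (\<lambda>i\<in>{..n}. s * full_coords n x i)) \<partial>lborel \<partial>?L)"
    by (rule P.Fubini') measurable
  also have "\<dots> = (\<integral>\<^sup>+x. ennreal K * (ennreal (dirichlet_density {..<n} n p x) *
      (\<integral>\<^sup>+s. ennreal (indicator {0<..} s * s powr (a - 1)) *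
        H (\<lambda>i\<in>{..n}. s * full_coords n x i) \<partial>lborel)) \<partial>?L)"
  proof (rule nn_integral_cong)
    fix x assume "x \<in> space ?L"
    then have x: "x \<in> space (Pi\<^sub>M {..<n} (\<lambda>_. borel :: real measure))" by (simp add: space_PiM)
    define h where "h s = H (\<lambda>i\<in>{..n}. s * full_coords n x i)" for s
    have [measurable]: "h \<in> borel_measurable borel"
      unfolding h_def using x by measurable
    have "(\<integral>\<^sup>+s. ennreal (indicator {0<..} s * s powr (a - 1)) *
        (ennreal (K * dirichlet_density {..<n} n p x) * h s) \<partial>lborel) =
      (\<integral>\<^sup>+s. ennreal (K * dirichlet_density {..<n} n p x) *
        (ennreal (indicator {0<..} s * s powr (a - 1)) * h s) \<partial>lborel)"
      by (intro nn_integral_cong) (simp add: mult_ac)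
    also have "\<dots> = ennreal (K * dirichlet_density {..<n} n p x) *
        (\<integral>\<^sup>+s. ennreal (indicator {0<..} s * s powr (a - 1)) * h s \<partial>lborel)"
      by (rule nn_integral_cmult) measurable
    finally show "(\<integral>\<^sup>+s. ennreal (indicator {0<..} s * s powr (a - 1)) *
      (ennreal (K * dirichlet_density {..<n} n p x) *
        H (\<lambda>i\<in>{..n}. s * full_coords n x i)) \<partial>lborel) =
     ennreal K * (ennreal (dirichlet_density {..<n} n p x) *
      (\<integral>\<^sup>+s. ennreal (indicator {0<..} s * s powr (a - 1)) *
        H (\<lambda>i\<in>{..n}. s * full_coords n x i) \<partial>lborel))"
      using K0 by (simp add: h_def[symmetric] ennreal_mult' mult.assoc)
  qed
  also have "\<dots> = ennreal K * (\<integral>\<^sup>+x. ennreal (dirichlet_density {..<n} n p x) *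
      (\<integral>\<^sup>+s. ennreal (indicator {0<..} s * s powr (a - 1)) *
        H (\<lambda>i\<in>{..n}. s * full_coords n x i) \<partial>lborel) \<partial>?L)"
    by (rule nn_integral_cmult) measurable
  also have "\<dots> = ennreal K * (\<integral>\<^sup>+x. \<integral>\<^sup>+s. ennreal (indicator {0<..} s * s powr (a - 1)) *
        H (\<lambda>i\<in>{..n}. s * full_coords n x i) \<partial>lborel \<partial>dirichlet_distr n p)"
    unfolding D by (subst nn_integral_density, measurable)
  finally show ?thesis unfolding F_def K_def .
qed

section \<open>Quasi-invariance of the Dirichlet distribution\<close>

lemma sum_full_coords: "(\<Sum>i\<le>n. full_coords n x i) = 1"
proof -
  have "{..n} = insert n {..<n}" by auto
  then show ?thesis by simp
qed

lemma AE_dirichlet_distr_full_coords_pos: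
  assumes p: "\<And>i. i \<le> n \<Longrightarrow> 0 < p i"
  shows "AE x in dirichlet_distr n p. \<forall>i\<le>n. 0 < full_coords n x i"
proof -
  have D: "dirichlet_distr n p = density (Pi\<^sub>M {..<n} (\<lambda>_. lborel)) (\<lambda>x. ennreal (dirichlet_density {..<n} n p x))"
    by (rule dirichlet_distr_pos) (rule p)
  have [measurable_cong]: "sets (Pi\<^sub>M {..<n} (\<lambda>_. lborel)) = sets (Pi\<^sub>M {..<n} (\<lambda>_. borel :: real measure))"
    by (rule sets_PiM_cong) auto
  have "insert n {..<n} = {..n}" by auto
  then have dens [measurable]: "dirichlet_density {..<n} n p \<in> borel_measurable (Pi\<^sub>M {..<n} (\<lambda>_. lborel))"
    unfolding dirichlet_density_def by measurable
  have "0 < full_coords n x i" if "0 < dirichlet_density {..<n} n p x" "i \<le> n" for x i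
    using that by (auto simp: dirichlet_density_def full_coords_def split: if_splits)
  moreover have "(\<lambda>x. ennreal (dirichlet_density {..<n} n p x)) \<in> borel_measurable (Pi\<^sub>M {..<n} (\<lambda>_. lborel))"
    by measurable
  ultimately show ?thesis
    unfolding D by (auto simp: AE_density)
qed

lemma nn_integral_Gamma_scaled:
  fixes a b :: real
  assumes a: "0 < a" and b: "0 < b"
  shows "(\<integral>\<^sup>+s. ennreal (indicator {0<..} s * s powr (a - 1)) * ennreal (exp (- (s * b))) \<partial>lborel) =
    ennreal (Gamma a * b powr (- a))"
proof -
  have "ennreal (Gamma a) = (\<integral>\<^sup>+t. ennreal (indicator {0..} t * t powr (a - 1) / exp t) \<partial>lborel)"
    by (rule Gamma_conv_nn_integral_real[OF a])
  also have "\<dots> = ennreal b * (\<integral>\<^sup>+s. ennreal (indicator {0..} (b * s) * (b * s) powr (a - 1) / exp (b * s)) \<partial>lborel)"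
    using b by (subst nn_integral_real_affine[where t=0 and c=b]) auto
  also have "\<dots> = ennreal b * (\<integral>\<^sup>+s. ennreal (b powr (a - 1)) *
      (ennreal (indicator {0<..} s * s powr (a - 1)) * ennreal (exp (- (s * b)))) \<partial>lborel)"
  proof (intro arg_cong2[where f="(*)"] nn_integral_cong refl)
    fix s :: real
    (* At s = 0 both sides vanish because 0 powr r = 0 for every r. *)
    have "indicator {0..} (b * s) * (b * s) powr (a - 1) / exp (b * s) =
        b powr (a - 1) * (indicator {0<..} s * s powr (a - 1)) * exp (- (s * b))"
      using b by (cases "0 < s"; cases "s = 0")
        (auto simp: indicator_def zero_le_mult_iff powr_mult exp_minus field_simps)
    then show "ennreal (indicator {0..} (b * s) * (b * s) powr (a - 1) / exp (b * s)) =
      ennreal (b powr (a - 1)) * (ennreal (indicator {0<..} s * s powr (a - 1)) * ennreal (exp (- (s * b))))"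
      by (simp add: ennreal_mult mult.assoc)
  qed
  also have "\<dots> = ennreal b * (ennreal (b powr (a - 1)) *
      (\<integral>\<^sup>+s. ennreal (indicator {0<..} s * s powr (a - 1)) * ennreal (exp (- (s * b))) \<partial>lborel))"
    by (subst nn_integral_cmult) auto
  also have "\<dots> = ennreal (b powr a) *
      (\<integral>\<^sup>+s. ennreal (indicator {0<..} s * s powr (a - 1)) * ennreal (exp (- (s * b))) \<partial>lborel)"
  proof -
    have "b * b powr (a - 1) = b powr a" using b by (simp add: powr_diff)
    then show ?thesis using b by (simp add: ennreal_mult'[symmetric] mult.assoc[symmetric])
  qed
  finally have eq: "ennreal (Gamma a) = ennreal (b powr a) *
      (\<integral>\<^sup>+s. ennreal (indicator {0<..} s * s powr (a - 1)) * ennreal (exp (- (s * b))) \<partial>lborel)" (is "_ = _ * ?J") .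
  have "ennreal (Gamma a * b powr (- a)) = ennreal (b powr (- a)) * (ennreal (b powr a) * ?J)"
    unfolding eq[symmetric] using Gamma_real_pos[OF a] by (simp add: ennreal_mult mult.commute)
  also have "\<dots> = ?J"
    using b by (simp add: mult.assoc[symmetric] ennreal_mult'[symmetric] powr_add[symmetric])
  finally show ?thesis by simp
qed

text \<open>
  The function \<open>exp (- \<Sum> y) * \<Phi> (y / \<Sum> y)\<close> is integrated against the weight on the orthant in two ways:
  in polar coordinates directly, and in polar coordinates after the coordinates have been rescaled by
  \<open>c\<close>.  In both cases the radial integral is a Gamma integral, and after the rescaling its rate
  is \<open>S x\<close>, which is where the factor \<open>S x powr (- a)\<close> comes from.
\<close>
proposition dirichlet_distr_quasi_invariant:
  fixes p c :: "nat \<Rightarrow> real" and n :: nat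
  defines "a \<equiv> \<Sum>i\<le>n. p i"
    and "S \<equiv> \<lambda>x. \<Sum>i\<le>n. c i * full_coords n x i"
  assumes p: "\<And>i. i \<le> n \<Longrightarrow> 0 < p i" and c: "\<And>i. i \<le> n \<Longrightarrow> 0 < c i"
    and \<Phi> [measurable]: "\<Phi> \<in> borel_measurable (Pi\<^sub>M {..n} (\<lambda>_. borel))"
  shows "(\<integral>\<^sup>+x. \<Phi> (\<lambda>i\<in>{..n}. c i * full_coords n x i / S x) * ennreal (S x powr (- a)) \<partial>dirichlet_distr n p) =
    ennreal (\<Prod>i\<le>n. c i powr (- p i)) * (\<integral>\<^sup>+x. \<Phi> (\<lambda>i\<in>{..n}. full_coords n x i) \<partial>dirichlet_distr n p)"
proof -
  let ?B = "Pi\<^sub>M {..n} (\<lambda>_. borel :: real measure)"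
  let ?L = "Pi\<^sub>M {..n} (\<lambda>_. lborel :: real measure)"
  have LB [measurable_cong]: "sets ?L = sets ?B" by (rule sets_PiM_cong) auto
  define K where "K = (\<Prod>i\<le>n. Gamma (p i)) / Gamma a"
  have a0: "0 < a" unfolding a_def using p by (intro sum_pos) auto
  have K0: "0 < K" unfolding K_def using p a0
    by (intro divide_pos_pos prod_pos) (auto intro: Gamma_real_pos)
  have G0: "0 < Gamma a" using a0 by (rule Gamma_real_pos)
  (* The exponential makes the radial integrals converge. *)
  define H where "H y = ennreal (exp (- (\<Sum>i\<le>n. y i))) * \<Phi> (\<lambda>i\<in>{..n}. y i / (\<Sum>i\<le>n. y i))" for y
  define H' where "H' y = H (\<lambda>i\<in>{..n}. c i * y i)" for y
  have H [measurable]: "H \<in> borel_measurable ?B" unfolding H_def by measurable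
  have H' [measurable]: "H' \<in> borel_measurable ?B" unfolding H'_def by measurable
  have w [measurable]: "power_weight n p \<in> borel_measurable ?B" by measurable
  have gam: "(\<integral>\<^sup>+s. ennreal (indicator {0<..} s * s powr (a - 1)) * (ennreal (exp (- (s * b))) * v) \<partial>lborel) =
      ennreal (Gamma a) * (ennreal (b powr (- a)) * v)" if "0 < b" for b v
    using nn_integral_Gamma_scaled[OF a0 that] a0
    by (subst mult.assoc[symmetric], subst nn_integral_multc)
      (auto simp: ennreal_mult' mult.assoc less_imp_le[OF Gamma_real_pos])
  have cone: "(\<integral>\<^sup>+y. ennreal (power_weight n p y) * G y \<partial>?L) = ennreal K *
      (\<integral>\<^sup>+x. \<integral>\<^sup>+s. ennreal (indicator {0<..} s * s powr (a - 1)) *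
        G (\<lambda>i\<in>{..n}. s * full_coords n x i) \<partial>lborel \<partial>dirichlet_distr n p)"
    if "G \<in> borel_measurable ?B" for G
    unfolding K_def a_def using p that by (rule nn_integral_power_weight)
  have 1: "(\<integral>\<^sup>+y. ennreal (power_weight n p y) * H y \<partial>?L) =
      ennreal K * (ennreal (Gamma a) * (\<integral>\<^sup>+x. \<Phi> (\<lambda>i\<in>{..n}. full_coords n x i) \<partial>dirichlet_distr n p))"
  proof -
    have "(\<integral>\<^sup>+s. ennreal (indicator {0<..} s * s powr (a - 1)) * H (\<lambda>i\<in>{..n}. s * full_coords n x i) \<partial>lborel) =
        ennreal (Gamma a) * \<Phi> (\<lambda>i\<in>{..n}. full_coords n x i)" for x
    proof -
      have "ennreal (indicator {0<..} s * s powr (a - 1)) * H (\<lambda>i\<in>{..n}. s * full_coords n x i) =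
        ennreal (indicator {0<..} s * s powr (a - 1)) * (ennreal (exp (- (s * 1))) * \<Phi> (\<lambda>i\<in>{..n}. full_coords n x i))" for s
      proof (cases "0 < s")
        case True
        have "(\<Sum>i\<le>n. (\<lambda>i\<in>{..n}. s * full_coords n x i) i) = s"
          using sum_full_coords[of n x] by (simp add: sum_distrib_left[symmetric])
        moreover have "(\<lambda>i\<in>{..n}. (\<lambda>i\<in>{..n}. s * full_coords n x i) i / s) = (\<lambda>i\<in>{..n}. full_coords n x i)"
          using True by (auto simp: restrict_def)
        ultimately show ?thesis unfolding H_def by (simp only: mult_1_right)
      qed simp
      then show ?thesis using gam[of 1] by simp
    qed
    moreover have "(\<lambda>x. \<Phi> (\<lambda>i\<in>{..n}. full_coords n x i)) \<in> borel_measurable (dirichlet_distr n p)"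
      unfolding dirichlet_distr_def Let_def by measurable
    ultimately show ?thesis
      unfolding cone[OF H]
      by (simp add: nn_integral_cmult)
  qed
  have 2: "(\<integral>\<^sup>+y. ennreal (power_weight n p y) * H' y \<partial>?L) =
      ennreal K * (ennreal (Gamma a) *
        (\<integral>\<^sup>+x. \<Phi> (\<lambda>i\<in>{..n}. c i * full_coords n x i / S x) * ennreal (S x powr (- a)) \<partial>dirichlet_distr n p))"
  proof -
    have pos: "AE x in dirichlet_distr n p. \<forall>i\<le>n. 0 < full_coords n x i"
      using p by (rule AE_dirichlet_distr_full_coords_pos)
    have "AE x in dirichlet_distr n p.
      (\<integral>\<^sup>+s. ennreal (indicator {0<..} s * s powr (a - 1)) * H' (\<lambda>i\<in>{..n}. s * full_coords n x i) \<partial>lborel) =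
        ennreal (Gamma a) * (\<Phi> (\<lambda>i\<in>{..n}. c i * full_coords n x i / S x) * ennreal (S x powr (- a)))"
      using pos
    proof eventually_elim
      fix x assume x: "\<forall>i\<le>n. 0 < full_coords n x i"
      then have S0: "0 < S x" unfolding S_def using c by (intro sum_pos) auto
      have "ennreal (indicator {0<..} s * s powr (a - 1)) * H' (\<lambda>i\<in>{..n}. s * full_coords n x i) =
        ennreal (indicator {0<..} s * s powr (a - 1)) * (ennreal (exp (- (s * S x))) * \<Phi> (\<lambda>i\<in>{..n}. c i * full_coords n x i / S x))" for s
      proof (cases "0 < s")
        case True
        have "(\<Sum>i\<le>n. (\<lambda>i\<in>{..n}. c i * (\<lambda>i\<in>{..n}. s * full_coords n x i) i) i) = s * S x"
          unfolding S_def sum_distrib_left by (intro sum.cong) auto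
        moreover have "(\<lambda>i\<in>{..n}. (\<lambda>i\<in>{..n}. c i * (\<lambda>i\<in>{..n}. s * full_coords n x i) i) i / (s * S x)) =
            (\<lambda>i\<in>{..n}. c i * full_coords n x i / S x)"
          using True by (auto simp: restrict_def)
        ultimately show ?thesis unfolding H_def H'_def by (simp only:)
      qed simp
      then show "(\<integral>\<^sup>+s. ennreal (indicator {0<..} s * s powr (a - 1)) * H' (\<lambda>i\<in>{..n}. s * full_coords n x i) \<partial>lborel) =
        ennreal (Gamma a) * (\<Phi> (\<lambda>i\<in>{..n}. c i * full_coords n x i / S x) * ennreal (S x powr (- a)))"
        by (simp only: gam[OF S0]) (simp only: mult_ac)
    qed
    moreover have "(\<lambda>x. \<Phi> (\<lambda>i\<in>{..n}. c i * full_coords n x i / S x) * ennreal (S x powr (- a)))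
        \<in> borel_measurable (dirichlet_distr n p)"
      unfolding dirichlet_distr_def Let_def S_def by measurable
    ultimately show ?thesis
      unfolding cone[OF H']
      by (simp add: nn_integral_cmult[symmetric] cong: nn_integral_cong_AE)
  qed
  let ?X = "\<integral>\<^sup>+x. \<Phi> (\<lambda>i\<in>{..n}. full_coords n x i) \<partial>dirichlet_distr n p"
  let ?Y = "\<integral>\<^sup>+x. \<Phi> (\<lambda>i\<in>{..n}. c i * full_coords n x i / S x) * ennreal (S x powr (- a)) \<partial>dirichlet_distr n p"
  have "(\<integral>\<^sup>+y. ennreal (power_weight n p y) * H y \<partial>?L) =
      ennreal (\<Prod>i\<le>n. c i) * (\<integral>\<^sup>+y. ennreal (power_weight n p (\<lambda>i\<in>{..n}. c i * y i)) * H' y \<partial>?L)"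
    unfolding H'_def using c by (intro nn_integral_PiM_lborel_scale) auto
  also have "\<dots> = ennreal (\<Prod>i\<le>n. c i) * (\<integral>\<^sup>+y. ennreal (\<Prod>i\<le>n. c i powr (p i - 1)) * (ennreal (power_weight n p y) * H' y) \<partial>?L)"
    using c by (simp add: power_weight_scale ennreal_mult' prod_nonneg mult.assoc)
  also have "\<dots> = ennreal (\<Prod>i\<le>n. c i) * (ennreal (\<Prod>i\<le>n. c i powr (p i - 1)) * (\<integral>\<^sup>+y. ennreal (power_weight n p y) * H' y \<partial>?L))"
    by (subst nn_integral_cmult, measurable)
  also have "\<dots> = ennreal (\<Prod>i\<le>n. c i powr p i) * (\<integral>\<^sup>+y. ennreal (power_weight n p y) * H' y \<partial>?L)"
  proof -
    have "(\<Prod>i\<le>n. c i) * (\<Prod>i\<le>n. c i powr (p i - 1)) = (\<Prod>i\<le>n. c i powr p i)"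
      unfolding prod.distrib[symmetric]
    proof (rule prod.cong)
      fix i assume "i \<in> {..n}"
      then show "c i * c i powr (p i - 1) = c i powr p i" using c[of i] by (simp add: powr_diff)
    qed simp
    moreover have "0 \<le> (\<Prod>i\<le>n. c i)" using c by (intro prod_nonneg) (auto intro: less_imp_le)
    ultimately show ?thesis by (simp only: mult.assoc[symmetric] ennreal_mult'[symmetric])
  qed
  finally have "ennreal (K * Gamma a) * ?X = ennreal (K * Gamma a) * (ennreal (\<Prod>i\<le>n. c i powr p i) * ?Y)"
    unfolding 1 2 using K0 G0 by (simp add: ennreal_mult' mult_ac)
  then have X: "?X = ennreal (\<Prod>i\<le>n. c i powr p i) * ?Y"
    using K0 G0 by (subst (asm) ennreal_mult_cancel_left) auto
  have "(\<Prod>i\<le>n. c i powr (- p i)) * (\<Prod>i\<le>n. c i powr p i) = 1"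
    unfolding prod.distrib[symmetric] using c by (intro prod.neutral ballI) (force simp: powr_add[symmetric])
  then show ?thesis
    unfolding X mult.assoc[symmetric] by (subst ennreal_mult'[symmetric]) (auto intro: prod_nonneg)
qed

section \<open>Quasi-invariance for simple functions of a Dirichlet random measure\<close>

lemma borel_measurable_vec_lambda [measurable (raw)]:
  fixes F :: "'a \<Rightarrow> 'd::finite \<Rightarrow> real"
  assumes "\<And>k. (\<lambda>x. F x k) \<in> borel_measurable M"
  shows "(\<lambda>x. \<chi> k. F x k) \<in> borel_measurable M"
  by (rule borel_measurable_euclidean_space[THEN iffD2])
    (auto simp: Basis_vec_def inner_axis intro!: assms)

lemma borel_measurable_component [measurable (raw)]:
  fixes F :: "'a \<Rightarrow> real^'d::finite"
  assumes "F \<in> borel_measurable M"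
  shows "(\<lambda>x. F x $ k) \<in> borel_measurable M"
  using assms by (rule measurable_compose) (intro borel_measurable_continuous_onI continuous_intros)

text \<open>
  The level sets of a simple function, with those of measure zero merged into one of positive measure,
  so that the Dirichlet distribution attached to the partition has a density.
\<close>
lemma simple_function_positive_cells:
  fixes M :: "'a measure" and g :: "'a \<Rightarrow> 'v"
  assumes "finite_measure M" and M0: "0 < measure M (space M)" and g: "simple_function M g"
  obtains n :: nat and C N e where
    "\<And>i. i \<le> n \<Longrightarrow> C i \<in> sets M" "disjoint_family_on C {..n}" "(\<Union>i\<le>n. C i) = space M"
    "\<And>i. i \<le> n \<Longrightarrow> 0 < measure M (C i)"
    "N \<in> sets M" "measure M N = 0" "\<And>i x. i \<le> n \<Longrightarrow> x \<in> C i - N \<Longrightarrow> g x = e i"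
proof -
  interpret finite_measure M by fact
  define L where "L v = g -` {v} \<inter> space M" for v
  have L [measurable]: "L v \<in> sets M" for v
    unfolding L_def using g by (rule simple_functionD)
  have fin: "finite (g ` space M)" using g by (rule simple_functionD)
  define V where "V = {v \<in> g ` space M. 0 < measure M (L v)}"
  have finV: "finite V" unfolding V_def using fin by auto
  define N where "N = (\<Union>v\<in>g ` space M - V. L v)"
  have N [measurable]: "N \<in> sets M" unfolding N_def using fin by (intro sets.finite_UN) auto
  have "measure M N \<le> (\<Sum>v\<in>g ` space M - V. measure M (L v))"
    unfolding N_def using fin by (intro finite_measure_subadditive_finite) auto
  also have "\<dots> = 0" by (intro sum.neutral) (auto simp: V_def not_less intro: antisym)
  finally have N0: "measure M N = 0" by (simp add: antisym)
  have cover: "space M \<subseteq> N \<union> (\<Union>v\<in>V. L v)" by (auto simp: N_def L_def)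
  have "V \<noteq> {}"
  proof
    assume "V = {}"
    then have "measure M (space M) \<le> measure M N"
      using cover by (intro finite_measure_mono) auto
    with M0 N0 show False by simp
  qed
  then obtain n where n: "card V = Suc n" using finV by (metis card_eq_0_iff not0_implies_Suc)
  obtain e where e: "bij_betw e {..n} V"
  proof -
    obtain e where "bij_betw e {0..<card V} V" using ex_bij_betw_nat_finite[OF finV] by auto
    moreover have "{0..<card V} = {..n}" using n by auto
    ultimately show ?thesis using that by simp
  qed
  define C where "C i = (if i = 0 then L (e 0) \<union> N else L (e i))" for i
  have eV: "e i \<in> V" if "i \<le> n" for i using e that by (auto simp: bij_betw_def)
  show ?thesis
  proof (rule that[of n C N e])
    show "disjoint_family_on C {..n}"
      unfolding disjoint_family_on_def
    proof (intro ballI impI)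
      fix i j assume ij: "i \<in> {..n}" "j \<in> {..n}" "i \<noteq> j"
      then have "e i \<noteq> e j" using e by (auto simp: bij_betw_def inj_on_def)
      then have "L (e i) \<inter> L (e j) = {}" by (auto simp: L_def)
      moreover have "L (e i) \<inter> N = {}" "L (e j) \<inter> N = {}"
        using eV ij by (auto simp: L_def N_def)
      ultimately show "C i \<inter> C j = {}" using ij(3) by (auto simp: C_def)
    qed
    show "(\<Union>i\<le>n. C i) = space M"
    proof
      show "(\<Union>i\<le>n. C i) \<subseteq> space M" by (auto simp: C_def L_def N_def split: if_splits)
      show "space M \<subseteq> (\<Union>i\<le>n. C i)"
      proof
        fix x assume "x \<in> space M"
        then consider "x \<in> N" | v where "v \<in> V" "x \<in> L v" using cover by auto
        then show "x \<in> (\<Union>i\<le>n. C i)"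
        proof cases
          case 1 then show ?thesis by (auto simp: C_def)
        next
          case 2
          then obtain i where i: "i \<le> n" "v = e i" using e by (auto simp: bij_betw_def)
          then have "x \<in> C i" using 2 by (auto simp: C_def)
          then show ?thesis using i by auto
        qed
      qed
    qed
    show "0 < measure M (C i)" if "i \<le> n" for i
    proof -
      have "0 < measure M (L (e i))" using eV[OF that] by (simp add: V_def)
      also have "\<dots> \<le> measure M (C i)" by (intro finite_measure_mono) (auto simp: C_def)
      finally show ?thesis .
    qed
    show "C i \<in> sets M" for i unfolding C_def using L N by auto
    show "g x = e i" if "x \<in> C i - N" for i x
      using that by (auto simp: C_def L_def split: if_splits)
  qed (use N N0 in auto)
qed

lemma integral_cells:
  fixes F :: "'a \<Rightarrow> real"
  assumes "finite_measure M"
    and C: "\<And>i. i \<le> (n::nat) \<Longrightarrow> C i \<in> sets M" "disjoint_family_on C {..n}" "(\<Union>i\<le>n. C i) = space M"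
    and N: "N \<in> sets M" "measure M N = 0"
    and F: "\<And>i x. i \<le> n \<Longrightarrow> x \<in> C i - N \<Longrightarrow> F x = u i" and Fm: "F \<in> borel_measurable M"
  shows "(\<integral>x. F x \<partial>M) = (\<Sum>i\<le>n. measure M (C i) * u i)"
proof -
  interpret finite_measure M by fact
  have "AE x in M. x \<notin> N"
    using N by (intro AE_not_in) (auto simp: null_sets_def emeasure_eq_measure)
  then have ae: "AE x in M. F x = (\<Sum>i\<le>n. indicator (C i) x * u i)"
  proof (rule AE_mp, intro AE_I2 impI)
    fix x assume x: "x \<in> space M" "x \<notin> N"
    then obtain j where j: "j \<le> n" "x \<in> C j" using C(3) by auto
    have "indicator (C i) x * u i = (if i = j then u i else 0)" if "i \<le> n" for i
      using C(2) that j by (auto simp: disjoint_family_on_def indicator_def)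
    then have "(\<Sum>i\<le>n. indicator (C i) x * u i) = (\<Sum>i\<le>n. if i = j then u i else 0)"
      by (intro sum.cong) auto
    also have "\<dots> = u j" using j by simp
    finally show "F x = (\<Sum>i\<le>n. indicator (C i) x * u i)" using F[OF j(1)] j x by simp
  qed
  have "(\<lambda>x. \<Sum>i\<le>n. indicator (C i) x * u i) \<in> borel_measurable M"
    using C by (intro borel_measurable_sum borel_measurable_times borel_measurable_indicator borel_measurable_const) auto
  then have "(\<integral>x. F x \<partial>M) = (\<integral>x. (\<Sum>i\<le>n. indicator (C i) x * u i) \<partial>M)"
    using ae Fm by (intro integral_cong_AE)
  also have "\<dots> = (\<Sum>i\<le>n. measure M (C i) * u i)"
    using C by (subst Bochner_Integration.integral_sum) (auto simp: emeasure_eq_measure)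
  finally show ?thesis .
qed

locale dirichlet_random_measure =
  fixes \<alpha> :: "'a measure" and P :: "'w measure" and m :: "'w \<Rightarrow> 'a measure"
  assumes finite_measure_\<alpha>: "finite_measure \<alpha>"
    and total_pos: "0 < measure \<alpha> (space \<alpha>)"
    and prob_space_P: "prob_space P"
    and functional_dirichlet: "functional_dirichlet P \<alpha> m"
begin

sublocale \<alpha>: finite_measure \<alpha> by (rule finite_measure_\<alpha>)
sublocale P: prob_space P by (rule prob_space_P)

abbreviation total :: real where "total \<equiv> measure \<alpha> (space \<alpha>)"

lemma kernel: "m \<in> measurable P (prob_algebra \<alpha>)"
  using functional_dirichlet by (simp add: functional_dirichlet_def)

lemma
  assumes "\<omega> \<in> space P"
  shows prob_space_m: "prob_space (m \<omega>)"
    and sets_m: "sets (m \<omega>) = sets \<alpha>"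
    and space_m: "space (m \<omega>) = space \<alpha>"
proof -
  have "m \<omega> \<in> space (prob_algebra \<alpha>)" using measurable_space[OF kernel assms] .
  then show "prob_space (m \<omega>)" and s: "sets (m \<omega>) = sets \<alpha>" by (auto simp: space_prob_algebra)
  show "space (m \<omega>) = space \<alpha>" by (rule sets_eq_imp_space_eq[OF s])
qed

lemma measurable_m: "\<omega> \<in> space P \<Longrightarrow> measurable (m \<omega>) N = measurable \<alpha> N"
  by (rule measurable_cong_sets[OF sets_m refl])

lemma measurable_measure_m:
  "A \<in> sets \<alpha> \<Longrightarrow> (\<lambda>\<omega>. measure (m \<omega>) A) \<in> borel_measurable P"
  by (rule measure_measurable_subprob_algebra2[OF pair_measureI[OF sets.top] measurable_prob_algebraD[OF kernel]])

lemma measurable_integral_m: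
  fixes h :: "'a \<Rightarrow> real"
  assumes "h \<in> borel_measurable \<alpha>"
  shows "(\<lambda>\<omega>. \<integral>x. h x \<partial>m \<omega>) \<in> borel_measurable P"
proof -
  have "(\<lambda>\<omega>. \<chi> k::unit. \<integral>x. h x \<partial>m \<omega>) \<in> borel_measurable P"
    using assms kernel by (rule measurable_mean)
  then have "(\<lambda>\<omega>. (\<chi> k::unit. \<integral>x. h x \<partial>m \<omega>) $ ()) \<in> borel_measurable P"
    by (rule borel_measurable_component)
  then show ?thesis by simp
qed

lemma distr_cells:
  assumes "\<And>i. i \<le> n \<Longrightarrow> C i \<in> sets \<alpha>" "disjoint_family_on C {..n}" "(\<Union>i\<le>n. C i) = space \<alpha>"
  shows "distr P (Pi\<^sub>M {..<n} (\<lambda>_. borel)) (\<lambda>\<omega>. \<lambda>i\<in>{..<n}. measure (m \<omega>) (C i)) =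
    dirichlet_distr n (\<lambda>i. measure \<alpha> (C i))"
  using functional_dirichlet assms by (auto simp: functional_dirichlet_def)

text \<open>
  The two-cell partition into \<open>A\<close> and its complement has parameter \<open>(0, a)\<close>, and the first component of
  its Dirichlet distribution is identically zero.
\<close>
lemma AE_m_null:
  assumes A: "A \<in> sets \<alpha>" and A0: "measure \<alpha> A = 0"
  shows "AE \<omega> in P. measure (m \<omega>) A = 0"
proof -
  define C where "C i = (if i = 0 then A else space \<alpha> - A)" for i :: nat
  define p where "p i = measure \<alpha> (C i)" for i
  have one: "{..1::nat} = {0, 1}" by auto
  have p: "p 0 = 0" "0 < p 1"
    using A A0 total_pos by (auto simp: p_def C_def \<alpha>.finite_measure_compl)
  have I: "{i\<in>{..1}. 0 < p i} = {1}" unfolding one using p by auto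
  have X: "(\<lambda>\<omega>. \<lambda>i\<in>{..<1}. measure (m \<omega>) (C i)) \<in> measurable P (Pi\<^sub>M {..<1::nat} (\<lambda>_. borel))"
    using A by (intro measurable_restrict measurable_measure_m) (auto simp: C_def)
  have "distr P (Pi\<^sub>M {..<1} (\<lambda>_. borel)) (\<lambda>\<omega>. \<lambda>i\<in>{..<1}. measure (m \<omega>) (C i)) = dirichlet_distr 1 p"
    unfolding p_def using A sets.sets_into_space[OF A]
    by (intro distr_cells) (auto simp: C_def one disjoint_family_on_def)
  moreover have "AE x in dirichlet_distr 1 p. x 0 = 0"
    unfolding dirichlet_distr_def Let_def I
    by (subst AE_distr_iff) (auto simp: lessThan_Suc)
  ultimately have "AE x in distr P (Pi\<^sub>M {..<1} (\<lambda>_. borel)) (\<lambda>\<omega>. \<lambda>i\<in>{..<1}. measure (m \<omega>) (C i)). x 0 = 0"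
    by (simp only:)
  then have "AE \<omega> in P. (\<lambda>i\<in>{..<1}. measure (m \<omega>) (C i)) 0 = 0"
    by (subst (asm) AE_distr_iff[OF X]) auto
  then show ?thesis by (simp add: C_def)
qed

text \<open>
  On a partition on which \<open>g\<close> and \<open>c\<close> are constant, outside a null set, all integrals are linear
  functions of the masses of the cells, whose law is Dirichlet; so this is
  \<open>dirichlet_distr_quasi_invariant\<close> read on the random measure.
\<close>
proposition quasi_invariant_simple:
  fixes g :: "'a \<Rightarrow> real^'d::finite" and c :: "'a \<Rightarrow> real" and h :: "real^'d \<Rightarrow> ennreal"
  assumes g: "simple_function \<alpha> g" and c: "simple_function \<alpha> c"
    and c_pos: "\<And>x. x \<in> space \<alpha> \<Longrightarrow> 0 < c x" and h [measurable]: "h \<in> borel_measurable borel"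
  shows "(\<integral>\<^sup>+\<omega>. h (\<chi> k. (\<integral>x. c x * g x $ k \<partial>m \<omega>) / (\<integral>x. c x \<partial>m \<omega>)) *
        ennreal ((\<integral>x. c x \<partial>m \<omega>) powr (- total)) \<partial>P) =
    ennreal (exp (- (\<integral>x. ln (c x) \<partial>\<alpha>))) * (\<integral>\<^sup>+\<omega>. h (\<chi> k. \<integral>x. g x $ k \<partial>m \<omega>) \<partial>P)"
proof -
  have [measurable]: "g \<in> borel_measurable \<alpha>" "c \<in> borel_measurable \<alpha>"
    using g c by (auto intro: borel_measurable_simple_function)
  obtain n :: nat and C N e where C: "\<And>i. i \<le> n \<Longrightarrow> C i \<in> sets \<alpha>" "disjoint_family_on C {..n}" "(\<Union>i\<le>n. C i) = space \<alpha>"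
    and C_pos: "\<And>i. i \<le> n \<Longrightarrow> 0 < measure \<alpha> (C i)"
    and N: "N \<in> sets \<alpha>" "measure \<alpha> N = 0" and e: "\<And>i x. i \<le> n \<Longrightarrow> x \<in> C i - N \<Longrightarrow> (g x, c x) = e i"
    by (rule simple_function_positive_cells[OF finite_measure_\<alpha> total_pos simple_function_Pair[OF g c]]) blast
  define p where "p i = measure \<alpha> (C i)" for i
  define b where "b i = snd (e i)" for i
  define v where "v i = fst (e i)" for i
  define X where "X \<omega> = (\<lambda>i\<in>{..<n}. measure (m \<omega>) (C i))" for \<omega>
  have vb: "g x = v i" "c x = b i" if "i \<le> n" "x \<in> C i - N" for i x
    using e[OF that] by (simp_all add: v_def b_def prod_eq_iff)
  have b_pos: "0 < b i" if "i \<le> n" for i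
  proof -
    have "\<not> C i \<subseteq> N"
      using \<alpha>.finite_measure_mono[of "C i" N] N C_pos[OF that] by auto
    then obtain x where x: "x \<in> C i - N" by auto
    then have "x \<in> space \<alpha>" using C(1)[OF that] sets.sets_into_space by auto
    then show ?thesis using c_pos[of x] vb[OF that x] by simp
  qed
  have total: "(\<Sum>i\<le>n. p i) = total"
    unfolding p_def C(3)[symmetric] using C
    by (intro \<alpha>.finite_measure_finite_Union[symmetric]) auto
  have law: "distr P (Pi\<^sub>M {..<n} (\<lambda>_. borel)) X = dirichlet_distr n p"
    unfolding X_def p_def by (rule distr_cells[OF C])
  have X [measurable]: "X \<in> measurable P (Pi\<^sub>M {..<n} (\<lambda>_. borel))"
    unfolding X_def using C by (intro measurable_restrict measurable_measure_m) auto
  define \<Phi> where "\<Phi> y = h (\<chi> k. \<Sum>i\<le>n. y i * v i $ k)" for y :: "nat \<Rightarrow> real"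
  have [measurable]: "\<Phi> \<in> borel_measurable (Pi\<^sub>M {..n} (\<lambda>_. borel))"
    unfolding \<Phi>_def by measurable
  have cells: "(\<integral>x. F x \<partial>m \<omega>) = (\<Sum>i\<le>n. full_coords n (X \<omega>) i * u i)"
    if "measure (m \<omega>) N = 0" "\<omega> \<in> space P" "F \<in> borel_measurable \<alpha>" "\<And>i x. i \<le> n \<Longrightarrow> x \<in> C i - N \<Longrightarrow> F x = u i"
    for \<omega> F u
  proof -
    interpret m: prob_space "m \<omega>" using that by (intro prob_space_m)
    have fm: "finite_measure (m \<omega>)" by unfold_locales
    have C': "\<And>i. i \<le> n \<Longrightarrow> C i \<in> sets (m \<omega>)" "(\<Union>i\<le>n. C i) = space (m \<omega>)" "N \<in> sets (m \<omega>)"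
      using C N that by (auto simp: sets_m space_m)
    have "(\<Sum>i\<le>n. measure (m \<omega>) (C i)) = measure (m \<omega>) (\<Union>i\<le>n. C i)"
      using C C' by (intro m.finite_measure_finite_Union[symmetric]) auto
    then have s: "(\<Sum>i\<le>n. measure (m \<omega>) (C i)) = 1" unfolding C' by (simp add: m.prob_space)
    have "full_coords n (X \<omega>) i = measure (m \<omega>) (C i)" if "i \<le> n" for i
    proof (cases "i = n")
      case True
      have "{..n} = insert n {..<n}" by auto
      then show ?thesis using s True by (simp add: X_def)
    qed (use that in \<open>simp add: X_def\<close>)
    then show ?thesis
      using integral_cells[OF fm C'(1) C(2) C'(2) C'(3) that(1) that(4)] that by (simp add: measurable_m)
  qed
  have base: "AE \<omega> in P. \<omega> \<in> space P \<and> measure (m \<omega>) N = 0"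
    using AE_m_null[OF N] by (auto intro: AE_I2)
  have "(\<integral>\<^sup>+\<omega>. h (\<chi> k. (\<integral>x. c x * g x $ k \<partial>m \<omega>) / (\<integral>x. c x \<partial>m \<omega>)) *
        ennreal ((\<integral>x. c x \<partial>m \<omega>) powr (- total)) \<partial>P) =
      (\<integral>\<^sup>+\<omega>. \<Phi> (\<lambda>i\<in>{..n}. b i * full_coords n (X \<omega>) i / (\<Sum>i\<le>n. b i * full_coords n (X \<omega>) i)) *
        ennreal ((\<Sum>i\<le>n. b i * full_coords n (X \<omega>) i) powr (- total)) \<partial>P)"
  proof (rule nn_integral_cong_AE, use base in eventually_elim)
    fix \<omega> assume \<omega>: "\<omega> \<in> space P \<and> measure (m \<omega>) N = 0"
    have 1: "(\<integral>x. c x \<partial>m \<omega>) = (\<Sum>i\<le>n. b i * full_coords n (X \<omega>) i)"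
      using \<omega> vb cells[of \<omega> c b] by (simp add: mult.commute)
    have 2: "(\<integral>x. c x * g x $ k \<partial>m \<omega>) = (\<Sum>i\<le>n. b i * full_coords n (X \<omega>) i * v i $ k)" for k
      using \<omega> vb cells[of \<omega> "\<lambda>x. c x * g x $ k" "\<lambda>i. b i * v i $ k"] by (simp add: mult_ac)
    show "h (\<chi> k. (\<integral>x. c x * g x $ k \<partial>m \<omega>) / (\<integral>x. c x \<partial>m \<omega>)) *
        ennreal ((\<integral>x. c x \<partial>m \<omega>) powr (- total)) =
      \<Phi> (\<lambda>i\<in>{..n}. b i * full_coords n (X \<omega>) i / (\<Sum>i\<le>n. b i * full_coords n (X \<omega>) i)) *
        ennreal ((\<Sum>i\<le>n. b i * full_coords n (X \<omega>) i) powr (- total))"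
      unfolding 1 2 \<Phi>_def by (simp add: sum_divide_distrib)
  qed
  also have "\<dots> = (\<integral>\<^sup>+x. \<Phi> (\<lambda>i\<in>{..n}. b i * full_coords n x i / (\<Sum>i\<le>n. b i * full_coords n x i)) *
        ennreal ((\<Sum>i\<le>n. b i * full_coords n x i) powr (- total)) \<partial>dirichlet_distr n p)"
    unfolding law[symmetric] by (subst nn_integral_distr, measurable)
  also have "\<dots> = ennreal (\<Prod>i\<le>n. b i powr (- p i)) * (\<integral>\<^sup>+x. \<Phi> (\<lambda>i\<in>{..n}. full_coords n x i) \<partial>dirichlet_distr n p)"
    unfolding total[symmetric] using C_pos b_pos
    by (intro dirichlet_distr_quasi_invariant) (auto simp: p_def)
  also have "(\<integral>\<^sup>+x. \<Phi> (\<lambda>i\<in>{..n}. full_coords n x i) \<partial>dirichlet_distr n p) =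
      (\<integral>\<^sup>+\<omega>. \<Phi> (\<lambda>i\<in>{..n}. full_coords n (X \<omega>) i) \<partial>P)"
    unfolding law[symmetric] by (subst nn_integral_distr, measurable)
  also have "\<dots> = (\<integral>\<^sup>+\<omega>. h (\<chi> k. \<integral>x. g x $ k \<partial>m \<omega>) \<partial>P)"
  proof (rule nn_integral_cong_AE, use base in eventually_elim)
    fix \<omega> assume \<omega>: "\<omega> \<in> space P \<and> measure (m \<omega>) N = 0"
    have "(\<integral>x. g x $ k \<partial>m \<omega>) = (\<Sum>i\<le>n. full_coords n (X \<omega>) i * v i $ k)" for k
      using \<omega> vb cells[of \<omega> "\<lambda>x. g x $ k" "\<lambda>i. v i $ k"] by simp
    then show "\<Phi> (\<lambda>i\<in>{..n}. full_coords n (X \<omega>) i) = h (\<chi> k. \<integral>x. g x $ k \<partial>m \<omega>)"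
      by (simp add: \<Phi>_def)
  qed
  also have "(\<Prod>i\<le>n. b i powr (- p i)) = exp (- (\<integral>x. ln (c x) \<partial>\<alpha>))"
  proof -
    have "(\<integral>x. ln (c x) \<partial>\<alpha>) = (\<Sum>i\<le>n. p i * ln (b i))"
      unfolding p_def using vb by (intro integral_cells[OF finite_measure_\<alpha> C N]) auto
    moreover have "(\<Prod>i\<le>n. b i powr (- p i)) = (\<Prod>i\<le>n. exp (- (p i * ln (b i))))"
    proof (rule prod.cong)
      fix i assume "i \<in> {..n}"
      then show "b i powr (- p i) = exp (- (p i * ln (b i)))" using b_pos[of i] by (simp add: powr_def)
    qed simp
    ultimately show ?thesis by (simp add: exp_sum sum_negf[symmetric])
  qed
  finally show ?thesis .
qed

end

section \<open>Integrability and positivity\<close>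

context dirichlet_random_measure
begin

text \<open>
  Comparing the total masses of the two laws in \<open>quasi_invariant_simple\<close> gives the Markov-Krein identity.
\<close>
lemma expectation_powr_simple:
  assumes c: "simple_function \<alpha> c" and c_pos: "\<And>x. x \<in> space \<alpha> \<Longrightarrow> 0 < c x"
  shows "(\<integral>\<^sup>+\<omega>. ennreal ((\<integral>x. c x \<partial>m \<omega>) powr (- total)) \<partial>P) = ennreal (exp (- (\<integral>x. ln (c x) \<partial>\<alpha>)))"
  using quasi_invariant_simple[of "\<lambda>_. 0 :: real^1" c "\<lambda>_. 1"] assms by (simp add: P.emeasure_space_1)

text \<open>
  Where \<open>m(A) = 0\<close>, the random variable \<open>(1 + t * m(A)) powr (- a)\<close> equals \<open>1\<close> for every \<open>t\<close>, while
  its expectation \<open>(1 + t) powr (- \<alpha>(A))\<close> tends to \<open>0\<close> as \<open>t\<close> grows.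
\<close>
lemma AE_m_pos:
  assumes A [measurable]: "A \<in> sets \<alpha>" and A_pos: "0 < measure \<alpha> A"
  shows "AE \<omega> in P. 0 < measure (m \<omega>) A"
proof -
  define Z where "Z = {\<omega> \<in> space P. measure (m \<omega>) A = 0}"
  have [measurable]: "(\<lambda>\<omega>. measure (m \<omega>) A) \<in> borel_measurable P" by (rule measurable_measure_m[OF A])
  have Z: "Z \<in> sets P" unfolding Z_def by measurable
  have "P.prob Z \<le> (1 + real t) powr (- measure \<alpha> A)" for t :: nat
  proof -
    let ?c = "\<lambda>x. 1 + real t * indicator A x :: real"
    have int: "(\<integral>x. ?c x \<partial>m \<omega>) = 1 + t * measure (m \<omega>) A" if "\<omega> \<in> space P" for \<omega>
    proof -
      interpret m: prob_space "m \<omega>" by (rule prob_space_m[OF that])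
      have "A \<in> sets (m \<omega>)" using sets_m[OF that] A by simp
      then show ?thesis by (simp add: m.emeasure_eq_measure m.prob_space)
    qed
    have "emeasure P Z = (\<integral>\<^sup>+\<omega>. indicator Z \<omega> \<partial>P)" using Z by simp
    (* On Z the integral of ?c is 1, so its power is 1 as well. *)
    also have "\<dots> \<le> (\<integral>\<^sup>+\<omega>. ennreal ((\<integral>x. ?c x \<partial>m \<omega>) powr (- total)) \<partial>P)"
    proof (rule nn_integral_mono)
      fix \<omega> assume \<omega>: "\<omega> \<in> space P"
      show "indicator Z \<omega> \<le> ennreal ((\<integral>x. ?c x \<partial>m \<omega>) powr (- total))"
        unfolding int[OF \<omega>] by (cases "\<omega> \<in> Z") (auto simp: Z_def)
    qed
    also have "\<dots> = ennreal (exp (- (\<integral>x. ln (?c x) \<partial>\<alpha>)))"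
      by (intro expectation_powr_simple simple_function_add simple_function_mult simple_function_const
          simple_function_indicator A) (auto simp: indicator_def)
    also have "(\<integral>x. ln (?c x) \<partial>\<alpha>) = (\<integral>x. ln (1 + real t) * indicator A x \<partial>\<alpha>)"
      by (intro Bochner_Integration.integral_cong) (auto simp: indicator_def)
    also have "\<dots> = ln (1 + real t) * measure \<alpha> A" by simp
    finally show ?thesis by (simp add: P.emeasure_eq_measure powr_def mult.commute)
  qed
  moreover have "(\<lambda>t. (1 + real t) powr (- measure \<alpha> A)) \<longlonglongrightarrow> 0"
    using A_pos by (intro tendsto_neg_powr filterlim_tendsto_add_at_top[OF tendsto_const] filterlim_real_sequentially) auto
  ultimately have "P.prob Z \<le> 0" by (intro LIMSEQ_le_const) auto
  then have "Z \<in> null_sets P" using Z by (auto simp: null_sets_def P.emeasure_eq_measure measure_le_0_iff)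
  then have "AE \<omega> in P. \<omega> \<notin> Z" by (rule AE_not_in)
  then show ?thesis
    by (rule AE_mp) (auto intro!: AE_I2 simp: Z_def zero_less_measure_iff)
qed

text \<open>
  The Markov-Krein identity for simple functions increasing to \<open>1 + t * |f|\<close> bounds the probability
  that \<open>f\<close> is integrable for \<open>m\<close> from below by \<open>exp (- \<integral> ln (1 + t * |f|) d\<alpha>)\<close>, since
  \<open>(1 + t * m(|f|)) powr (- a)\<close> is at most \<open>1\<close> and vanishes where \<open>m(|f|)\<close> is infinite.  Log-integrability
  lets this bound tend to \<open>1\<close> as \<open>t\<close> tends to \<open>0\<close>.
\<close>
proposition AE_integrable_m:
  fixes f :: "'a \<Rightarrow> real"
  assumes f [measurable]: "f \<in> borel_measurable \<alpha>" and log: "integrable \<alpha> (\<lambda>x. ln (1 + \<bar>f x\<bar>))"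
  shows "AE \<omega> in P. integrable (m \<omega>) f"
proof -
  obtain g where inc: "incseq g" and simple: "\<And>i. simple_function \<alpha> (g i)"
    and bdd: "\<And>x. bdd_above (range (\<lambda>i. g i x))" and g0: "\<And>i x. 0 \<le> g i x" and sup: "(\<lambda>x. \<bar>f x\<bar>) = (SUP i. g i)"
    using borel_measurable_implies_simple_function_sequence_real[of "\<lambda>x. \<bar>f x\<bar>" \<alpha>] by auto
  have [measurable]: "g i \<in> borel_measurable \<alpha>" for i
    using simple by (rule borel_measurable_simple_function)
  have incx: "incseq (\<lambda>i. g i x)" for x using inc by (auto simp: incseq_def le_fun_def)
  have limx: "(\<lambda>i. g i x) \<longlonglongrightarrow> \<bar>f x\<bar>" for x
    using LIMSEQ_incseq_SUP[OF bdd incx, of x] fun_cong[OF sup, of x] by (simp add: SUP_apply image_image)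
  have gle: "g i x \<le> \<bar>f x\<bar>" for i x by (rule incseq_le[OF incx limx])
  have "m \<in> measurable P (subprob_algebra \<alpha>)" using kernel by (rule measurable_prob_algebraD)
  from measurable_compose[OF this nn_integral_measurable_subprob_algebra]
  have [measurable]: "(\<lambda>\<omega>. \<integral>\<^sup>+x. ennreal \<bar>f x\<bar> \<partial>m \<omega>) \<in> borel_measurable P" by simp
  (* The exceptional event; the aim is to bound its probability by 1 - exp (- J t) for all small t. *)
  define B where "B = {\<omega> \<in> space P. (\<integral>\<^sup>+x. ennreal \<bar>f x\<bar> \<partial>m \<omega>) = \<infinity>}"
  have B [measurable]: "B \<in> sets P" unfolding B_def by measurable
  have integrable_g: "integrable (m \<omega>) (g n)" if "\<omega> \<in> space P" for n \<omega>
  proof -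
    interpret m: prob_space "m \<omega>" by (rule prob_space_m[OF that])
    have "finite (g n ` space \<alpha>)" using simple by (rule simple_functionD)
    then obtain K where "\<And>x. x \<in> space \<alpha> \<Longrightarrow> g n x \<le> K"
      by (metis finite_imageI bdd_above.E bdd_above_finite imageI)
    then show ?thesis using g0 that
      by (intro m.integrable_const_bound[where B=K]) (auto intro!: AE_I2 simp: space_m measurable_m)
  qed
  have I_top: "filterlim (\<lambda>n. \<integral>x. g n x \<partial>m \<omega>) at_top sequentially" if "\<omega> \<in> B" for \<omega>
  proof -
    have \<omega>: "\<omega> \<in> space P" using that by (auto simp: B_def)
    have "(\<lambda>n. \<integral>\<^sup>+x. ennreal (g n x) \<partial>m \<omega>) \<longlonglongrightarrow> (\<integral>\<^sup>+x. ennreal \<bar>f x\<bar> \<partial>m \<omega>)"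
      using inc limx by (intro nn_integral_LIMSEQ tendsto_ennrealI)
        (auto simp: measurable_m[OF \<omega>] incseq_def le_fun_def intro!: ennreal_leI)
    moreover have "(\<integral>\<^sup>+x. ennreal (g n x) \<partial>m \<omega>) = ennreal (\<integral>x. g n x \<partial>m \<omega>)" for n
      using g0 by (intro nn_integral_eq_integral integrable_g[OF \<omega>]) auto
    ultimately show ?thesis
      using that by (simp add: B_def ennreal_tendsto_top_eq_at_top)
  qed
  define J where "J t = (\<integral>x. ln (1 + t * \<bar>f x\<bar>) \<partial>\<alpha>)" for t
  have log_t: "integrable \<alpha> (\<lambda>x. ln (1 + t * \<bar>f x\<bar>))" "\<bar>ln (1 + t * \<bar>f x\<bar>)\<bar> \<le> ln (1 + \<bar>f x\<bar>)"
    if t: "0 < t" "t \<le> 1" for t x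
  proof -
    have b: "\<bar>ln (1 + t * \<bar>f x\<bar>)\<bar> \<le> ln (1 + \<bar>f x\<bar>)" for x
    proof -
      have 1: "0 \<le> t * \<bar>f x\<bar>" "t * \<bar>f x\<bar> \<le> 1 * \<bar>f x\<bar>" using t mult_right_mono[of t 1 "\<bar>f x\<bar>"] by auto
      then have "0 \<le> ln (1 + t * \<bar>f x\<bar>)" by (intro ln_ge_zero) simp
      moreover have "ln (1 + t * \<bar>f x\<bar>) \<le> ln (1 + \<bar>f x\<bar>)" using 1 by (subst ln_le_cancel_iff) linarith+
      ultimately show ?thesis by simp
    qed
    then show "\<bar>ln (1 + t * \<bar>f x\<bar>)\<bar> \<le> ln (1 + \<bar>f x\<bar>)" .
    show "integrable \<alpha> (\<lambda>x. ln (1 + t * \<bar>f x\<bar>))"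
      using b by (intro Bochner_Integration.integrable_bound[OF log]) (auto intro!: AE_I2 order_trans[OF b abs_ge_self])
  qed
  have lower: "exp (- J t) \<le> 1 - P.prob B" if t: "0 < t" "t \<le> 1" for t
  proof -
    define r where "r n \<omega> = (1 + t * (\<integral>x. g n x \<partial>m \<omega>)) powr (- total)" for n \<omega>
    have I_meas [measurable]: "(\<lambda>\<omega>. \<integral>x. g n x \<partial>m \<omega>) \<in> borel_measurable P" for n
      by (rule measurable_integral_m) measurable
    have r [measurable]: "r n \<in> borel_measurable P" for n unfolding r_def by measurable
    have r1: "r n \<omega> \<le> 1" for n \<omega>
    proof -
      have "1 \<le> 1 + t * (\<integral>x. g n x \<partial>m \<omega>)"
        using t g0 by (auto intro!: mult_nonneg_nonneg Bochner_Integration.integral_nonneg)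
      then show ?thesis
        unfolding r_def using powr_mono[of "- total" 0 "1 + t * (\<integral>x. g n x \<partial>m \<omega>)"] total_pos by simp
    qed
    have r0: "0 \<le> r n \<omega>" for n \<omega> by (simp add: r_def)
    have "ennreal (exp (- J t)) \<le> emeasure P (space P - B) + (\<integral>\<^sup>+\<omega>. ennreal (r n \<omega> * indicator B \<omega>) \<partial>P)" for n
    proof -
      have int: "(\<integral>x. 1 + t * g n x \<partial>m \<omega>) = 1 + t * (\<integral>x. g n x \<partial>m \<omega>)" if "\<omega> \<in> space P" for \<omega>
      proof -
        interpret m: prob_space "m \<omega>" by (rule prob_space_m[OF that])
        show ?thesis using integrable_g[OF that, of n] by (simp add: m.prob_space)
      qed
      have le: "ln (1 + t * g n x) \<le> ln (1 + t * \<bar>f x\<bar>)" for x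
        using t g0[of n x] gle[of n x]
        by (subst ln_le_cancel_iff) (auto intro!: add_pos_nonneg)
      have ge: "0 \<le> ln (1 + t * g n x)" for x
        using t g0[of n x] by (intro ln_ge_zero) simp
      have "integrable \<alpha> (\<lambda>x. ln (1 + t * g n x))"
        using ge le by (intro Bochner_Integration.integrable_bound[OF log_t(1)[OF t]]) (auto intro!: AE_I2 order_trans[OF le])
      then have "(\<integral>x. ln (1 + t * g n x) \<partial>\<alpha>) \<le> J t"
        unfolding J_def using le log_t(1)[OF t] by (intro integral_mono) auto
      then have "ennreal (exp (- J t)) \<le> ennreal (exp (- (\<integral>x. ln (1 + t * g n x) \<partial>\<alpha>)))"
        by (intro ennreal_leI) simp
      also have "\<dots> = (\<integral>\<^sup>+\<omega>. ennreal ((\<integral>x. 1 + t * g n x \<partial>m \<omega>) powr (- total)) \<partial>P)"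
        using t g0 simple by (intro expectation_powr_simple[symmetric] simple_function_compose2[where h="\<lambda>_ y. 1 + t * y"])
          (auto intro!: add_pos_nonneg)
      also have "\<dots> = (\<integral>\<^sup>+\<omega>. ennreal (r n \<omega>) \<partial>P)"
        by (intro nn_integral_cong) (simp add: int r_def)
      also have "\<dots> \<le> (\<integral>\<^sup>+\<omega>. indicator (space P - B) \<omega> + ennreal (r n \<omega> * indicator B \<omega>) \<partial>P)"
        using r1 by (intro nn_integral_mono) (auto simp: indicator_def intro: ennreal_le_1[THEN iffD2])
      also have "\<dots> = emeasure P (space P - B) + (\<integral>\<^sup>+\<omega>. ennreal (r n \<omega> * indicator B \<omega>) \<partial>P)"
        by (subst nn_integral_add) auto
      finally show ?thesis .
    qed
    moreover have "(\<lambda>n. \<integral>\<^sup>+\<omega>. ennreal (r n \<omega> * indicator B \<omega>) \<partial>P) \<longlonglongrightarrow> (\<integral>\<^sup>+\<omega>. 0 \<partial>P)"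
    proof (rule nn_integral_dominated_convergence[where w="\<lambda>_. 1"])
      show "AE \<omega> in P. (\<lambda>n. ennreal (r n \<omega> * indicator B \<omega>)) \<longlonglongrightarrow> 0"
      proof (rule AE_I2)
        fix \<omega>
        show "(\<lambda>n. ennreal (r n \<omega> * indicator B \<omega>)) \<longlonglongrightarrow> 0"
        proof (cases "\<omega> \<in> B")
          case True
          have "(\<lambda>n. r n \<omega>) \<longlonglongrightarrow> 0" unfolding r_def using t total_pos
            by (intro tendsto_neg_powr filterlim_tendsto_add_at_top[OF tendsto_const]
                filterlim_tendsto_pos_mult_at_top[OF tendsto_const] I_top True) auto
          from tendsto_ennrealI[OF this] show ?thesis using True by simp
        qed simp
      qed
      show "(\<integral>\<^sup>+\<omega>. 1 \<partial>P) < \<infinity>" by (simp add: P.emeasure_space_1)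
    qed (use r1 in \<open>auto intro!: AE_I2 simp: indicator_def\<close>)
    ultimately have "ennreal (exp (- J t)) \<le> emeasure P (space P - B) + 0"
      by (intro LIMSEQ_le_const[OF tendsto_add[OF tendsto_const]]) auto
    then show ?thesis by (simp add: P.emeasure_eq_measure P.prob_compl)
  qed
  have "(\<lambda>n. J (1 / (1 + real n))) \<longlonglongrightarrow> (\<integral>x. 0 \<partial>\<alpha>)"
    unfolding J_def
  proof (rule integral_dominated_convergence[where w="\<lambda>x. ln (1 + \<bar>f x\<bar>)"])
    show "AE x in \<alpha>. (\<lambda>n. ln (1 + 1 / (1 + real n) * \<bar>f x\<bar>)) \<longlonglongrightarrow> 0"
    proof (rule AE_I2)
      fix x
      have "(\<lambda>n. 1 / (1 + real n)) \<longlonglongrightarrow> 0"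
        using LIMSEQ_inverse_real_of_nat by (simp add: inverse_eq_divide add.commute)
      then have "(\<lambda>n. ln (1 + 1 / (1 + real n) * \<bar>f x\<bar>)) \<longlonglongrightarrow> ln (1 + 0 * \<bar>f x\<bar>)"
        by (intro tendsto_intros) auto
      then show "(\<lambda>n. ln (1 + 1 / (1 + real n) * \<bar>f x\<bar>)) \<longlonglongrightarrow> 0" by simp
    qed
    show "AE x in \<alpha>. norm (ln (1 + 1 / (1 + real n) * \<bar>f x\<bar>)) \<le> ln (1 + \<bar>f x\<bar>)" for n
      using log_t(2)[of "1 / (1 + real n)"] by (auto intro!: AE_I2)
  qed (use log in auto)
  then have "(\<lambda>n. exp (- J (1 / (1 + real n)))) \<longlonglongrightarrow> exp (- 0)"
    by (intro tendsto_exp tendsto_minus) simp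
  then have "exp (- 0) \<le> 1 - P.prob B"
    by (rule LIMSEQ_le_const2) (auto intro!: lower)
  then have "B \<in> null_sets P" using B by (auto simp: null_sets_def P.emeasure_eq_measure measure_le_0_iff)
  then have "AE \<omega> in P. \<omega> \<notin> B" by (rule AE_not_in)
  then show ?thesis
    by (rule AE_mp) (auto intro!: AE_I2 simp: B_def integrable_iff_bounded measurable_m less_top)
qed

end

section \<open>Quasi-invariance for general integrands\<close>

context dirichlet_random_measure
begin

text \<open>
  Both sides of \<open>quasi_invariant_simple\<close> pass to the limit along simple functions converging to \<open>f\<close> and
  dominated by it, provided the test function is continuous and bounded; the indicator of a closed set
  is a decreasing limit of such functions.  The weight \<open>m(c) powr (- a)\<close> stays bounded because \<open>c\<close>
  is positive and takes only finitely many values.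
\<close>
proposition quasi_invariant_closed:
  fixes f :: "'d::finite \<Rightarrow> 'a \<Rightarrow> real" and c :: "'a \<Rightarrow> real" and S :: "(real^'d) set"
  assumes f [measurable]: "\<And>k. f k \<in> borel_measurable \<alpha>"
    and int: "AE \<omega> in P. \<forall>k. integrable (m \<omega>) (f k)"
    and c: "simple_function \<alpha> c" and c_pos: "\<And>x. x \<in> space \<alpha> \<Longrightarrow> 0 < c x"
    and S: "closed S"
  shows "(\<integral>\<^sup>+\<omega>. indicator S (\<chi> k. (\<integral>x. c x * f k x \<partial>m \<omega>) / (\<integral>x. c x \<partial>m \<omega>)) *
        ennreal ((\<integral>x. c x \<partial>m \<omega>) powr (- total)) \<partial>P) =
    ennreal (exp (- (\<integral>x. ln (c x) \<partial>\<alpha>))) * (\<integral>\<^sup>+\<omega>. indicator S (\<chi> k. \<integral>x. f k x \<partial>m \<omega>) \<partial>P)"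
proof -
  define K where "K = exp (- (\<integral>x. ln (c x) \<partial>\<alpha>))"
  have c_meas [measurable]: "c \<in> borel_measurable \<alpha>" using c by (rule borel_measurable_simple_function)
  have "space \<alpha> \<noteq> {}" using total_pos by auto
  moreover have "finite (c ` space \<alpha>)" using c by (rule simple_functionD)
  ultimately obtain \<delta> M where \<delta>: "0 < \<delta>" and bounds: "\<And>x. x \<in> space \<alpha> \<Longrightarrow> \<delta> \<le> c x \<and> c x \<le> M"
    using c_pos that[of "Min (c ` space \<alpha>)" "Max (c ` space \<alpha>)"] by auto
  define W where "W \<omega> = (\<integral>x. c x \<partial>m \<omega>) powr (- total)" for \<omega>
  define Y where "Y f \<omega> = (\<chi> k. \<integral>x. f k x \<partial>m \<omega>)" for f :: "'d \<Rightarrow> 'a \<Rightarrow> real" and \<omega>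
  define Yc where "Yc f \<omega> = (\<chi> k. (\<integral>x. c x * f k x \<partial>m \<omega>) / (\<integral>x. c x \<partial>m \<omega>))" for f :: "'d \<Rightarrow> 'a \<Rightarrow> real" and \<omega>
  have mass [measurable]: "(\<lambda>\<omega>. \<integral>x. c x \<partial>m \<omega>) \<in> borel_measurable P" by (rule measurable_integral_m[OF c_meas])
  have W [measurable]: "W \<in> borel_measurable P" unfolding W_def by measurable
  have Y [measurable]: "Y g \<in> borel_measurable P" if "\<And>k. g k \<in> borel_measurable \<alpha>" for g
    unfolding Y_def using that by (intro borel_measurable_vec_lambda measurable_integral_m)
  have Yc [measurable]: "Yc g \<in> borel_measurable P" if g: "\<And>k. g k \<in> borel_measurable \<alpha>" for g
    unfolding Yc_def using g
    by (intro borel_measurable_vec_lambda borel_measurable_divide measurable_integral_m borel_measurable_times c_meas)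
  have mass_ge: "\<delta> \<le> (\<integral>x. c x \<partial>m \<omega>)" if "\<omega> \<in> space P" for \<omega>
  proof -
    interpret m: prob_space "m \<omega>" by (rule prob_space_m[OF that])
    have "integrable (m \<omega>) c"
      using bounds \<delta> by (intro m.integrable_const_bound[where B=M])
        (auto intro!: AE_I2 simp: space_m[OF that] measurable_m[OF that] abs_of_pos c_pos)
    then have "(\<integral>x. \<delta> \<partial>m \<omega>) \<le> (\<integral>x. c x \<partial>m \<omega>)"
      using bounds by (intro integral_mono) (auto simp: space_m[OF that])
    then show ?thesis by (simp add: m.prob_space)
  qed
  define b where "b = \<delta> powr (- total)"
  have W_le: "W \<omega> \<le> b" if "\<omega> \<in> space P" for \<omega>
    unfolding W_def b_def using mass_ge[OF that] \<delta> total_pos by (intro powr_mono2') auto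
  have limits: "(\<lambda>n. \<integral>\<^sup>+\<omega>. ennreal (u n \<omega>) \<partial>P) \<longlonglongrightarrow> (\<integral>\<^sup>+\<omega>. ennreal (v \<omega>) \<partial>P)"
      "(\<lambda>n. \<integral>\<^sup>+\<omega>. ennreal (u n \<omega>) * ennreal (W \<omega>) \<partial>P) \<longlonglongrightarrow> (\<integral>\<^sup>+\<omega>. ennreal (v \<omega>) * ennreal (W \<omega>) \<partial>P)"
    if [measurable]: "\<And>n. u n \<in> borel_measurable P" "v \<in> borel_measurable P"
      and u: "\<And>n \<omega>. 0 \<le> u n \<omega>" "\<And>n \<omega>. u n \<omega> \<le> 1" and lim: "AE \<omega> in P. (\<lambda>n. u n \<omega>) \<longlonglongrightarrow> v \<omega>"
    for u v
  proof -
    show "(\<lambda>n. \<integral>\<^sup>+\<omega>. ennreal (u n \<omega>) \<partial>P) \<longlonglongrightarrow> (\<integral>\<^sup>+\<omega>. ennreal (v \<omega>) \<partial>P)"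
    proof (rule nn_integral_dominated_convergence[where w="\<lambda>_. 1"])
      show "AE \<omega> in P. (\<lambda>n. ennreal (u n \<omega>)) \<longlonglongrightarrow> ennreal (v \<omega>)"
        using lim by eventually_elim (rule tendsto_ennrealI)
    qed (use u in \<open>auto simp: P.emeasure_space_1\<close>)
    show "(\<lambda>n. \<integral>\<^sup>+\<omega>. ennreal (u n \<omega>) * ennreal (W \<omega>) \<partial>P) \<longlonglongrightarrow> (\<integral>\<^sup>+\<omega>. ennreal (v \<omega>) * ennreal (W \<omega>) \<partial>P)"
    proof (rule nn_integral_dominated_convergence[where w="\<lambda>_. ennreal b"])
      show "AE \<omega> in P. (\<lambda>n. ennreal (u n \<omega>) * ennreal (W \<omega>)) \<longlonglongrightarrow> ennreal (v \<omega>) * ennreal (W \<omega>)"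
        using lim
      proof eventually_elim
        fix \<omega> assume "(\<lambda>n. u n \<omega>) \<longlonglongrightarrow> v \<omega>"
        then have "(\<lambda>n. ennreal (u n \<omega> * W \<omega>)) \<longlonglongrightarrow> ennreal (v \<omega> * W \<omega>)"
          by (intro tendsto_ennrealI tendsto_intros)
        then show "(\<lambda>n. ennreal (u n \<omega>) * ennreal (W \<omega>)) \<longlonglongrightarrow> ennreal (v \<omega>) * ennreal (W \<omega>)"
          by (simp add: W_def ennreal_mult'')
      qed
      show "AE \<omega> in P. ennreal (u n \<omega>) * ennreal (W \<omega>) \<le> ennreal b" for n
      proof (rule AE_I2)
        fix \<omega> assume \<omega>: "\<omega> \<in> space P"
        have "u n \<omega> * W \<omega> \<le> 1 * b" using u W_le[OF \<omega>] by (intro mult_mono) (auto simp: W_def)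
        then show "ennreal (u n \<omega>) * ennreal (W \<omega>) \<le> ennreal b"
          by (subst ennreal_mult''[symmetric]) (auto simp: W_def intro: ennreal_leI)
      qed
      show "(\<integral>\<^sup>+\<omega>. ennreal b \<partial>P) < \<infinity>" by (simp add: P.emeasure_space_1)
    qed auto
  qed
  have continuous: "(\<integral>\<^sup>+\<omega>. ennreal (h (Yc f \<omega>)) * ennreal (W \<omega>) \<partial>P) = ennreal K * (\<integral>\<^sup>+\<omega>. ennreal (h (Y f \<omega>)) \<partial>P)"
    if h: "continuous_on UNIV h" and h01: "\<And>y. 0 \<le> h y" "\<And>y. h y \<le> 1" for h :: "real^'d \<Rightarrow> real"
  proof -
    have hm [measurable]: "h \<in> borel_measurable borel" using h by (rule borel_measurable_continuous_onI)
    have hY: "(\<lambda>\<omega>. h (Y g \<omega>)) \<in> borel_measurable P" "(\<lambda>\<omega>. h (Yc g \<omega>)) \<in> borel_measurable P"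
      if "\<And>k. g k \<in> borel_measurable \<alpha>" for g
      using measurable_compose[OF Y[OF that] hm] measurable_compose[OF Yc[OF that] hm] .
    have "(\<lambda>x. \<chi> k. f k x) \<in> borel_measurable \<alpha>" by measurable
    from borel_measurable_implies_sequence_metric[OF this, of 0]
    obtain F where F: "\<And>n. simple_function \<alpha> (F n)"
      and F_lim: "\<And>x. x \<in> space \<alpha> \<Longrightarrow> (\<lambda>n. F n x) \<longlonglongrightarrow> (\<chi> k. f k x)"
      and F_le: "\<And>n x. x \<in> space \<alpha> \<Longrightarrow> norm (F n x) \<le> 2 * norm (\<chi> k. f k x)"
      by (simp only: dist_norm diff_0_right) blast
    have [measurable]: "F n \<in> borel_measurable \<alpha>" for n
      using F by (rule borel_measurable_simple_function)
    define G where "G n k x = F n x $ k" for n k x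
    have G [measurable]: "G n k \<in> borel_measurable \<alpha>" for n k unfolding G_def by measurable
    have G_le: "\<bar>G n k x\<bar> \<le> 2 * (\<Sum>j\<in>UNIV. \<bar>f j x\<bar>)" if "x \<in> space \<alpha>" for n k x
      using component_le_norm_cart[of "F n x" k] F_le[OF that, of n] norm_le_l1_cart[of "\<chi> k. f k x"]
      by (simp add: G_def)
    have G_lim: "(\<lambda>n. G n k x) \<longlonglongrightarrow> f k x" if "x \<in> space \<alpha>" for k x
      using tendsto_vec_nth[OF F_lim[OF that], of k] by (simp add: G_def)
    have conv: "(\<lambda>n. \<integral>x. w x * G n k x \<partial>m \<omega>) \<longlonglongrightarrow> (\<integral>x. w x * f k x \<partial>m \<omega>)"
      if \<omega>: "\<omega> \<in> space P" "\<forall>k. integrable (m \<omega>) (f k)" and w [measurable]: "w \<in> borel_measurable \<alpha>"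
        and wM: "\<And>x. x \<in> space \<alpha> \<Longrightarrow> \<bar>w x\<bar> \<le> M'" for \<omega> k w M'
    proof (rule integral_dominated_convergence[where w="\<lambda>x. M' * (2 * (\<Sum>j\<in>UNIV. \<bar>f j x\<bar>))"])
      show "AE x in m \<omega>. (\<lambda>n. w x * G n k x) \<longlonglongrightarrow> w x * f k x"
        by (intro AE_I2 tendsto_intros G_lim) (simp add: space_m[OF \<omega>(1)])
      show "AE x in m \<omega>. norm (w x * G n k x) \<le> M' * (2 * (\<Sum>j\<in>UNIV. \<bar>f j x\<bar>))" for n
      proof (rule AE_I2)
        fix x assume "x \<in> space (m \<omega>)"
        then have x: "x \<in> space \<alpha>" by (simp add: space_m[OF \<omega>(1)])
        show "norm (w x * G n k x) \<le> M' * (2 * (\<Sum>j\<in>UNIV. \<bar>f j x\<bar>))"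
          unfolding real_norm_def abs_mult using wM[OF x] G_le[OF x]
          by (intro mult_mono) (auto intro: order_trans[OF abs_ge_zero])
      qed
      show "integrable (m \<omega>) (\<lambda>x. M' * (2 * (\<Sum>j\<in>UNIV. \<bar>f j x\<bar>)))"
        using \<omega>(2) by auto
    qed (simp_all add: measurable_m[OF \<omega>(1)])
    have base: "AE \<omega> in P. \<omega> \<in> space P \<and> (\<forall>k. integrable (m \<omega>) (f k))"
      using int by (auto intro: AE_I2)
    have lim: "AE \<omega> in P. (\<lambda>n. h (Y (G n) \<omega>)) \<longlonglongrightarrow> h (Y f \<omega>)"
      using base
    proof eventually_elim
      fix \<omega> assume \<omega>: "\<omega> \<in> space P \<and> (\<forall>k. integrable (m \<omega>) (f k))"
      have "(\<lambda>n. Y (G n) \<omega>) \<longlonglongrightarrow> Y f \<omega>"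
        unfolding Y_def using conv[of \<omega> "\<lambda>_. 1" 1] \<omega> by (intro tendsto_vec_lambda) simp
      then show "(\<lambda>n. h (Y (G n) \<omega>)) \<longlonglongrightarrow> h (Y f \<omega>)"
        by (rule continuous_on_tendsto_compose[OF h]) auto
    qed
    have lim_c: "AE \<omega> in P. (\<lambda>n. h (Yc (G n) \<omega>)) \<longlonglongrightarrow> h (Yc f \<omega>)"
      using base
    proof eventually_elim
      fix \<omega> assume \<omega>: "\<omega> \<in> space P \<and> (\<forall>k. integrable (m \<omega>) (f k))"
      then have "(\<integral>x. c x \<partial>m \<omega>) \<noteq> 0" using mass_ge[of \<omega>] \<delta> by auto
      moreover have "\<bar>c x\<bar> \<le> M" if "x \<in> space \<alpha>" for x using bounds[OF that] \<delta> by auto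
      ultimately have "(\<lambda>n. Yc (G n) \<omega>) \<longlonglongrightarrow> Yc f \<omega>"
        unfolding Yc_def using conv[of \<omega> c M] \<omega> by (intro tendsto_vec_lambda tendsto_divide tendsto_const) auto
      then show "(\<lambda>n. h (Yc (G n) \<omega>)) \<longlonglongrightarrow> h (Yc f \<omega>)"
        by (rule continuous_on_tendsto_compose[OF h]) auto
    qed
    have "(\<lambda>n. \<integral>\<^sup>+\<omega>. ennreal (h (Yc (G n) \<omega>)) * ennreal (W \<omega>) \<partial>P) \<longlonglongrightarrow>
        (\<integral>\<^sup>+\<omega>. ennreal (h (Yc f \<omega>)) * ennreal (W \<omega>) \<partial>P)"
      by (rule limits(2)[OF hY(2)[OF G] hY(2)[OF f] h01 lim_c])
    moreover have "(\<integral>\<^sup>+\<omega>. ennreal (h (Yc (G n) \<omega>)) * ennreal (W \<omega>) \<partial>P) =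
        ennreal K * (\<integral>\<^sup>+\<omega>. ennreal (h (Y (G n) \<omega>)) \<partial>P)" for n
      unfolding Yc_def Y_def W_def K_def G_def by (rule quasi_invariant_simple[OF F c c_pos]) auto
    moreover have "(\<lambda>n. ennreal K * (\<integral>\<^sup>+\<omega>. ennreal (h (Y (G n) \<omega>)) \<partial>P)) \<longlonglongrightarrow>
        ennreal K * (\<integral>\<^sup>+\<omega>. ennreal (h (Y f \<omega>)) \<partial>P)"
      by (intro ennreal_tendsto_cmult limits(1)[OF hY(1)[OF G] hY(1)[OF f] h01 lim]) simp
    ultimately show ?thesis by (simp add: LIMSEQ_unique)
  qed
  show ?thesis
  proof (cases "S = {}")
    case False
    define h where "h j y = max 0 (1 - real j * infdist y S)" for j y
    have h01: "0 \<le> h j y" "h j y \<le> 1" for j y by (auto simp: h_def infdist_nonneg)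
    have h: "continuous_on UNIV (h j)" for j unfolding h_def by (intro continuous_intros)
    then have hm: "h j \<in> borel_measurable borel" for j by (rule borel_measurable_continuous_onI)
    have h_lim: "(\<lambda>j. h j y) \<longlonglongrightarrow> indicator S y" for y
    proof (cases "y \<in> S")
      case True
      then show ?thesis by (simp add: h_def)
    next
      case F: False
      then have pos: "0 < infdist y S"
        using in_closed_iff_infdist_zero[OF S False, of y] infdist_nonneg[of y S] by auto
      obtain j0 :: nat where j0: "1 / infdist y S < real j0" using reals_Archimedean2 by blast
      have "h j y = 0" if "j0 \<le> j" for j
      proof -
        have "1 / infdist y S < real j" using j0 that by linarith
        then show ?thesis using pos by (simp add: h_def field_simps)
      qed
      then have "eventually (\<lambda>j. h j y = 0) sequentially" by (auto simp: eventually_sequentially)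
      then show ?thesis using F by (simp add: tendsto_eventually)
    qed
    have Sm: "indicator S \<in> borel_measurable (borel :: (real^'d) measure)" using S by simp
    have "(\<lambda>j. \<integral>\<^sup>+\<omega>. ennreal (h j (Yc f \<omega>)) * ennreal (W \<omega>) \<partial>P) \<longlonglongrightarrow>
        (\<integral>\<^sup>+\<omega>. ennreal (indicator S (Yc f \<omega>)) * ennreal (W \<omega>) \<partial>P)"
      using measurable_compose[OF Yc[OF f] hm] measurable_compose[OF Yc[OF f] Sm]
      by (rule limits(2)) (auto intro: h01 h_lim)
    moreover have "(\<lambda>j. ennreal K * (\<integral>\<^sup>+\<omega>. ennreal (h j (Y f \<omega>)) \<partial>P)) \<longlonglongrightarrow>
        ennreal K * (\<integral>\<^sup>+\<omega>. ennreal (indicator S (Y f \<omega>)) \<partial>P)"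
      using measurable_compose[OF Y[OF f] hm] measurable_compose[OF Y[OF f] Sm]
      by (intro ennreal_tendsto_cmult limits(1)) (auto intro: h01 h_lim)
    ultimately have "(\<integral>\<^sup>+\<omega>. ennreal (indicator S (Yc f \<omega>)) * ennreal (W \<omega>) \<partial>P) =
        ennreal K * (\<integral>\<^sup>+\<omega>. ennreal (indicator S (Y f \<omega>)) \<partial>P)"
      using continuous[OF h h01] by (simp add: LIMSEQ_unique)
    then show ?thesis unfolding Yc_def Y_def W_def K_def by (simp add: ennreal_indicator)
  qed simp
qed

end

section \<open>Frames in the support and null sets\<close>

definition frame_map :: "('e::euclidean_space \<Rightarrow> 'e) \<Rightarrow> 'e \<Rightarrow> 'e" where
  "frame_map y u = (\<Sum>b\<in>Basis. (u \<bullet> b) *\<^sub>R y b)"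

lemma linear_frame_map: "linear (frame_map y)"
  unfolding frame_map_def
  by (rule linearI) (simp_all add: inner_add_left inner_scaleR_left scaleR_add_left sum.distrib scaleR_sum_right)

lemma frame_map_diff: "frame_map (\<lambda>b. x b - y b) u = frame_map x u - frame_map y u"
  by (simp add: frame_map_def scaleR_diff_right sum_subtractf)

text \<open>
  The points outside the support are covered by open sets whose preimages are null, and by Lindelof
  countably many of them suffice.
\<close>
lemma AE_in_support:
  fixes F :: "'a \<Rightarrow> 'e::euclidean_space"
  assumes "finite_measure M" and F: "F \<in> borel_measurable M"
  shows "AE x in M. \<forall>\<epsilon>>0. 0 < measure M (F -` ball (F x) \<epsilon> \<inter> space M)"
proof -
  interpret finite_measure M by fact
  define \<U> where "\<U> = {B. open B \<and> measure M (F -` B \<inter> space M) = 0}"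
  obtain \<V> where \<V>: "\<V> \<subseteq> \<U>" "countable \<V>" "\<Union>\<V> = \<Union>\<U>"
    using Lindelof[of \<U>] by (auto simp: \<U>_def)
  have vim: "F -` B \<inter> space M \<in> sets M" if "open B" for B
    using F that by (intro measurable_sets) auto
  have "AE x in M. \<forall>B\<in>\<V>. F x \<notin> B"
  proof (subst AE_ball_countable[OF \<V>(2)], intro ballI)
    fix B assume "B \<in> \<V>"
    then have B: "open B" "measure M (F -` B \<inter> space M) = 0" using \<V>(1) by (auto simp: \<U>_def)
    then have "F -` B \<inter> space M \<in> null_sets M"
      using vim by (auto simp: null_sets_def emeasure_eq_measure)
    then have "AE x in M. x \<notin> F -` B \<inter> space M" by (rule AE_not_in)
    then show "AE x in M. F x \<notin> B" by (rule AE_mp) (auto intro: AE_I2)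
  qed
  then show ?thesis
  proof (rule AE_mp, intro AE_I2 impI allI)
    fix x and \<epsilon> :: real assume x: "\<forall>B\<in>\<V>. F x \<notin> B" and \<epsilon>: "0 < \<epsilon>"
    then have "F x \<notin> \<Union>\<U>" using \<V>(3) by auto
    then have "ball (F x) \<epsilon> \<notin> \<U>" using \<epsilon> by (meson UnionI centre_in_ball)
    then show "0 < measure M (F -` ball (F x) \<epsilon> \<inter> space M)"
      by (auto simp: \<U>_def zero_less_measure_iff)
  qed
qed

text \<open>
  An injective linear map is bounded below, and this survives a perturbation of each frame vector by
  \<open>\<epsilon>\<close>, which changes the map by at most \<open>DIM * \<epsilon>\<close> in norm.  Positive multiples of the frame vectors only
  rescale the coordinates of the argument.
\<close>
lemma inj_frame_map_perturbed:
  fixes x y :: "'e::euclidean_space \<Rightarrow> 'e"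
  assumes \<delta>: "\<And>u. \<delta> * norm u \<le> norm (frame_map x u)" and \<epsilon>: "real DIM('e) * \<epsilon> < \<delta>"
    and close: "\<And>b. b \<in> Basis \<Longrightarrow> norm (y b - x b) \<le> \<epsilon>" and w: "\<And>b. b \<in> Basis \<Longrightarrow> 0 < (w b :: real)"
  shows "inj (frame_map (\<lambda>b. w b *\<^sub>R y b))"
  unfolding linear_inj_iff_eq_0[OF linear_frame_map]
proof (intro allI impI)
  fix u :: 'e assume u0: "frame_map (\<lambda>b. w b *\<^sub>R y b) u = 0"
  define u' where "u' = (\<Sum>b\<in>Basis. ((u \<bullet> b) * w b) *\<^sub>R b)"
  have u': "u' \<bullet> b = (u \<bullet> b) * w b" if "b \<in> Basis" for b
    unfolding u'_def by (rule inner_sum_left_Basis[OF that])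
  have "frame_map y u' = frame_map (\<lambda>b. w b *\<^sub>R y b) u"
    unfolding frame_map_def by (intro sum.cong) (simp_all add: u')
  then have "frame_map x u' = frame_map (\<lambda>b. x b - y b) u'"
    using u0 by (simp add: frame_map_diff)
  also have "norm \<dots> \<le> (\<Sum>b\<in>Basis. norm ((u' \<bullet> b) *\<^sub>R (x b - y b)))"
    unfolding frame_map_def by (rule norm_sum)
  also have "\<dots> \<le> (\<Sum>b\<in>(Basis :: 'e set). norm u' * \<epsilon>)"
    using close by (intro sum_mono) (auto simp: norm_minus_commute intro!: mult_mono Basis_le_norm)
  finally have "norm (frame_map x u') \<le> real DIM('e) * \<epsilon> * norm u'" by (simp add: mult_ac)
  with \<delta>[of u'] have "(\<delta> - real DIM('e) * \<epsilon>) * norm u' \<le> 0" by (simp add: algebra_simps)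
  then have "u' = 0" using \<epsilon> by (simp add: mult_le_0_iff)
  then have "(u \<bullet> b) * w b = 0" if "b \<in> Basis" for b
    using u'[OF that] by (simp only: inner_zero_left)
  then have comp: "u \<bullet> b = 0" if "b \<in> Basis" for b
    using w[OF that] that by (metis less_irrefl mult_eq_0_iff)
  show "u = 0" by (rule euclidean_eqI) (simp add: comp)
qed

text \<open>
  If the support of the image measure lay in a hyperplane through the origin, a normal vector of it
  would violate the nondegeneracy; so the support contains a basis, and small balls around its members
  keep the basis property under arbitrary choices.
\<close>
proposition stable_frame_in_support:
  fixes F :: "'a \<Rightarrow> 'e::euclidean_space"
  assumes "finite_measure M" and F: "F \<in> borel_measurable M"
    and nondeg: "\<And>v. v \<noteq> 0 \<Longrightarrow> \<not> (AE x in M. v \<bullet> F x = 0)"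
  obtains x :: "'e \<Rightarrow> 'e" and \<epsilon> :: real where
    "\<And>b. b \<in> Basis \<Longrightarrow> 0 < measure M (F -` cball (x b) \<epsilon> \<inter> space M)"
    "\<And>b b'. b \<in> Basis \<Longrightarrow> b' \<in> Basis \<Longrightarrow> b \<noteq> b' \<Longrightarrow> cball (x b) \<epsilon> \<inter> cball (x b') \<epsilon> = {}"
    "\<And>y w. (\<And>b. b \<in> Basis \<Longrightarrow> y b \<in> cball (x b) \<epsilon>) \<Longrightarrow> (\<And>b. b \<in> Basis \<Longrightarrow> 0 < (w b :: real)) \<Longrightarrow>
       inj (frame_map (\<lambda>b. w b *\<^sub>R y b))"
proof -
  interpret finite_measure M by fact
  define S where "S = {y. \<forall>\<epsilon>>0. 0 < measure M (F -` ball y \<epsilon> \<inter> space M)}"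
  have FS: "AE x in M. F x \<in> S"
    using AE_in_support[OF assms(1) F] by (simp add: S_def)
  have span: "span S = UNIV"
  proof (rule ccontr)
    assume "span S \<noteq> UNIV"
    then obtain v where v: "v \<noteq> 0" "\<forall>y\<in>span S. v \<bullet> y = 0" using span_not_UNIV_orthogonal by auto
    have "AE x in M. v \<bullet> F x = 0"
      using FS by eventually_elim (use v(2) in \<open>auto intro: span_base\<close>)
    with nondeg[OF v(1)] show False by simp
  qed
  obtain B where B: "B \<subseteq> S" "independent B" "S \<subseteq> span B" by (rule maximal_independent_subset)
  have spanB: "span B = UNIV"
    using span span_mono[OF B(3)] by (simp add: span_span top.extremum_unique)
  have "card B = DIM('e)" using basis_card_eq_dim[of B UNIV] B spanB by (simp add: dim_UNIV)
  moreover have finB: "finite B" using B(2) by (rule independent_imp_finite)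
  ultimately obtain x where x: "bij_betw x (Basis :: 'e set) B"
    using finite_same_card_bij[of "Basis :: 'e set" B] by auto
  have "inj (frame_map x)"
    unfolding linear_inj_iff_eq_0[OF linear_frame_map]
  proof (intro allI impI)
    fix u assume "frame_map x u = 0"
    moreover have "frame_map x u = (\<Sum>y\<in>B. (u \<bullet> inv_into Basis x y) *\<^sub>R y)"
      unfolding frame_map_def using x
      by (subst sum.reindex_bij_betw[symmetric, OF x]) (auto intro!: sum.cong simp: bij_betw_def inv_into_f_f)
    ultimately have zero: "u \<bullet> inv_into Basis x y = 0" if "y \<in> B" for y
      using independentD[OF B(2) finB order_refl, of "\<lambda>y. u \<bullet> inv_into Basis x y"] that by auto
    have comp: "u \<bullet> b = 0" if "b \<in> Basis" for b
      using zero[of "x b"] x that by (auto simp: bij_betw_def inv_into_f_f)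
    show "u = 0" by (rule euclidean_eqI) (simp add: comp)
  qed
  then obtain \<delta> where \<delta>: "0 < \<delta>" "\<And>u. \<delta> * norm u \<le> norm (frame_map x u)"
    using linear_inj_bounded_below_pos[OF linear_frame_map] by metis
  (* Half of the largest radius that inj_frame_map_perturbed allows. *)
  define \<epsilon> where "\<epsilon> = \<delta> / (2 * real DIM('e))"
  have \<epsilon>: "0 < \<epsilon>" "real DIM('e) * \<epsilon> < \<delta>" using \<delta>(1) by (auto simp: \<epsilon>_def)
  have inj: "inj (frame_map (\<lambda>b. w b *\<^sub>R y b))"
    if "\<And>b. b \<in> Basis \<Longrightarrow> y b \<in> cball (x b) \<epsilon>" "\<And>b. b \<in> Basis \<Longrightarrow> 0 < (w b :: real)" for y w
    using \<delta>(2) \<epsilon>(2) that by (intro inj_frame_map_perturbed[of \<delta> x \<epsilon>]) (auto simp: dist_norm norm_minus_commute)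
  show ?thesis
  proof (rule that[of x \<epsilon>])
    fix b b' :: 'e assume b: "b \<in> Basis" "b' \<in> Basis" "b \<noteq> b'"
    show "cball (x b) \<epsilon> \<inter> cball (x b') \<epsilon> = {}"
    proof (rule ccontr)
      assume "cball (x b) \<epsilon> \<inter> cball (x b') \<epsilon> \<noteq> {}"
      then obtain z where z: "z \<in> cball (x b) \<epsilon>" "z \<in> cball (x b') \<epsilon>" by auto
      (* A common point of two balls could be chosen for both of them, but a basis has no repeated vector. *)
      define y where "y = (\<lambda>c. if c = b \<or> c = b' then z else x c)"
      have "inj (frame_map (\<lambda>c. 1 *\<^sub>R y c))"
        using z \<epsilon>(1) by (intro inj) (auto simp: y_def)
      moreover have "frame_map (\<lambda>c. 1 *\<^sub>R y c) c = y c" if "c \<in> Basis" for c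
      proof -
        have "frame_map (\<lambda>c. 1 *\<^sub>R y c) c = (\<Sum>b\<in>Basis. if b = c then y c else 0)"
          unfolding frame_map_def using that by (intro sum.cong) (auto simp: inner_Basis)
        then show ?thesis using that by simp
      qed
      moreover have "y b = y b'" by (simp add: y_def)
      ultimately show False using b by (metis injD)
    qed
  next
    fix b :: 'e assume "b \<in> Basis"
    then have "x b \<in> S" using x B(1) by (auto simp: bij_betw_def)
    then have "0 < measure M (F -` ball (x b) \<epsilon> \<inter> space M)" using \<epsilon>(1) by (simp add: S_def)
    also have "\<dots> \<le> measure M (F -` cball (x b) \<epsilon> \<inter> space M)"
      by (intro finite_measure_mono measurable_sets[OF F] vimage_mono Int_mono ball_subset_cball) auto
    finally show "0 < measure M (F -` cball (x b) \<epsilon> \<inter> space M)" .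
  qed (rule inj)
qed

text \<open>
  The cone is contained in the image of \<open>N \<times> \<real>\<close>, a null set, under the smooth map \<open>(y, t) \<mapsto> (t y, t)\<close>.
\<close>
lemma negligible_cone:
  fixes N :: "'e::euclidean_space set"
  assumes N: "negligible N"
  shows "negligible {z :: 'e \<times> real. snd z \<noteq> 0 \<and> fst z /\<^sub>R snd z \<in> N}"
proof -
  have "negligible (N \<times> (UNIV :: real set))"
  proof -
    obtain N' where N': "N \<subseteq> N'" "N' \<in> null_sets lborel"
      using N unfolding negligible_iff_null_sets null_sets_completion_iff2 by auto
    then have "N' \<times> (UNIV :: real set) \<in> null_sets (lborel \<Otimes>\<^sub>M lborel)"
      by (intro lborel.times_in_null_sets1) auto
    then have "N' \<times> (UNIV :: real set) \<in> null_sets lebesgue"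
      by (simp add: lborel_prod null_sets_completionI)
    then show ?thesis
      unfolding negligible_iff_null_sets[symmetric] using N'(1) by (auto intro: negligible_subset)
  qed
  moreover have "(\<lambda>z :: 'e \<times> real. (snd z *\<^sub>R fst z, snd z)) differentiable_on (N \<times> UNIV)"
  proof (rule differentiable_at_imp_differentiable_on)
    fix z :: "'e \<times> real"
    have "((\<lambda>z :: 'e \<times> real. (snd z *\<^sub>R fst z, snd z)) has_derivative
        (\<lambda>h. (snd z *\<^sub>R fst h + snd h *\<^sub>R fst z, snd h))) (at z)"
      by (intro derivative_intros)
    then show "(\<lambda>z :: 'e \<times> real. (snd z *\<^sub>R fst z, snd z)) differentiable at z"
      by (auto simp: differentiable_def)
  qed
  ultimately have "negligible ((\<lambda>z :: 'e \<times> real. (snd z *\<^sub>R fst z, snd z)) ` (N \<times> UNIV))"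
    by (intro negligible_differentiable_image_negligible) auto
  then show ?thesis
  proof (rule negligible_subset, safe)
    fix y :: 'e and t :: real
    assume "snd (y, t) \<noteq> 0" "fst (y, t) /\<^sub>R snd (y, t) \<in> N"
    then show "(y, t) \<in> (\<lambda>z. (snd z *\<^sub>R fst z, snd z)) ` (N \<times> UNIV)"
      by (intro image_eqI[where x="(y /\<^sub>R t, t)"]) auto
  qed
qed

lemma negligible_affine_preimage:
  fixes L :: "'e::euclidean_space \<Rightarrow> 'e"
  assumes L: "linear L" "inj L" and Z: "negligible Z"
  shows "negligible {u. L u + r \<in> Z}"
proof -
  obtain L' where L': "linear L'" "L' \<circ> L = id" using linear_injective_left_inverse[OF L] by auto
  have "(\<lambda>z. L' (z - r)) differentiable_on Z"
  proof (rule differentiable_at_imp_differentiable_on)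
    fix z
    have "((\<lambda>z. z - r) has_derivative (\<lambda>h. h)) (at z)"
      by (auto intro!: derivative_eq_intros)
    from bounded_linear.has_derivative[OF linear_conv_bounded_linear[THEN iffD1, OF L'(1)] this]
    have "((\<lambda>z. L' (z - r)) has_derivative L') (at z)" .
    then show "(\<lambda>z. L' (z - r)) differentiable at z" by (auto simp: differentiable_def)
  qed
  then have "negligible ((\<lambda>z. L' (z - r)) ` Z)"
    using Z by (intro negligible_differentiable_image_negligible) auto
  then show ?thesis
  proof (rule negligible_subset, safe)
    fix u assume "L u + r \<in> Z"
    then show "u \<in> (\<lambda>z. L' (z - r)) ` Z"
      by (intro image_eqI[where x="L u + r"]) (simp_all add: pointfree_idE[OF L'(2)])
  qed
qed

text \<open>
  An affine relation between the components of \<open>f\<close> is a linear relation between those of \<open>(f, 1)\<close>;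
  a relation that only involves the constant component is impossible since \<open>\<alpha>\<close> is not zero.
\<close>
lemma affinely_nondegenerateD:
  fixes f :: "'d::finite \<Rightarrow> 'a \<Rightarrow> real" and v :: "(real^'d) \<times> real"
  assumes "finite_measure \<alpha>" and pos: "0 < measure \<alpha> (space \<alpha>)"
    and f [measurable]: "\<And>k. f k \<in> borel_measurable \<alpha>"
    and nondeg: "\<not> affinely_degenerate \<alpha> f" and v: "v \<noteq> 0"
  shows "\<not> (AE x in \<alpha>. v \<bullet> (\<chi> k. f k x, 1) = 0)"
proof
  interpret finite_measure \<alpha> by fact
  assume ae: "AE x in \<alpha>. v \<bullet> (\<chi> k. f k x, 1) = 0"
  obtain p s where ps: "v = (p, s)" by (cases v)
  have inner: "v \<bullet> (\<chi> k. f k x, 1) = (\<Sum>j\<in>UNIV. p $ j * f j x) + s" for x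
    by (simp add: ps inner_vec_def)
  define D where "D = {x \<in> space \<alpha>. (\<Sum>j\<in>UNIV. p $ j * f j x) = - s}"
  have "D \<in> sets \<alpha>" unfolding D_def by measurable
  moreover have "AE x in \<alpha>. x \<in> D"
    using ae by (rule AE_mp) (auto intro!: AE_I2 simp: inner D_def)
  ultimately have full: "measure \<alpha> D = measure \<alpha> (space \<alpha>)"
    by (intro finite_measure_eq_AE) auto
  show False
  proof (cases "p = 0")
    case True
    then have "s \<noteq> 0" using v ps by (auto simp: zero_prod_def)
    then have "D = {}" using True by (simp add: D_def)
    then show False using full pos by simp
  next
    case False
    then show False using nondeg full unfolding affinely_degenerate_def D_def by blast
  qed
qed

section \<open>Absolute continuity\<close>

context dirichlet_random_measure
begin

text \<open>
  The normalised integral of \<open>(f, 1)\<close> over \<open>A\<close> is an average of vectors in a ball, so it stays in the ball.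
\<close>
lemma cell_average_in_cball:
  fixes f :: "'d::finite \<Rightarrow> 'a \<Rightarrow> real" and y :: "(real^'d) \<times> real"
  assumes \<omega>: "\<omega> \<in> space P" and int: "\<And>k. integrable (m \<omega>) (f k)"
    and A: "A \<in> sets \<alpha>" and A_pos: "0 < measure (m \<omega>) A"
    and near: "\<And>x. x \<in> A \<Longrightarrow> (\<chi> k. f k x, 1) \<in> cball y \<epsilon>"
  shows "(\<chi> k. \<integral>x. indicator A x * f k x \<partial>m \<omega>, measure (m \<omega>) A) /\<^sub>R measure (m \<omega>) A \<in> cball y \<epsilon>"
proof -
  interpret m: prob_space "m \<omega>" by (rule prob_space_m[OF \<omega>])
  have A': "A \<in> sets (m \<omega>)" using A by (simp add: sets_m[OF \<omega>])
  define F where "F x = (\<chi> k. f k x, 1 :: real)" for x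
  define V where "V = (\<chi> k. \<integral>x. indicator A x * f k x \<partial>m \<omega>, measure (m \<omega>) A)"
  have expand: "(\<chi> k. g k, t) = (\<Sum>k\<in>UNIV. g k *\<^sub>R (axis k 1, 0)) + t *\<^sub>R (0, 1 :: real)" for g :: "'d \<Rightarrow> real" and t :: real
    by (auto simp: prod_eq_iff vec_eq_iff fst_sum snd_sum axis_def if_distrib cong: if_cong)
  have indf: "integrable (m \<omega>) (\<lambda>x. indicator A x * f k x)" for k
    using integrable_mult_indicator[OF A' int[of k]] by simp
  have "indicator A x *\<^sub>R F x = (\<Sum>k\<in>UNIV. (indicator A x * f k x) *\<^sub>R (axis k 1, 0)) + indicator A x *\<^sub>R (0, 1 :: real)" for x
    unfolding F_def by (subst expand) (simp add: scaleR_sum_right scaleR_add_right)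
  moreover have "has_bochner_integral (m \<omega>) (\<lambda>x. (\<Sum>k\<in>UNIV. (indicator A x * f k x) *\<^sub>R (axis k 1, 0)) + indicator A x *\<^sub>R (0, 1 :: real)) 
     ((\<Sum>k\<in>UNIV. (\<integral>x. indicator A x * f k x \<partial>m \<omega>) *\<^sub>R (axis k 1, 0)) + measure (m \<omega>) A *\<^sub>R (0, 1 :: real))"
    using indf A'
    by (intro has_bochner_integral_add has_bochner_integral_sum has_bochner_integral_scaleR_left
        has_bochner_integral_integrable has_bochner_integral_real_indicator) (auto simp: m.emeasure_eq_measure)
  ultimately have F: "has_bochner_integral (m \<omega>) (\<lambda>x. indicator A x *\<^sub>R F x) V"
    unfolding V_def by (subst expand) simp
  have y: "has_bochner_integral (m \<omega>) (\<lambda>x. indicator A x *\<^sub>R y) (measure (m \<omega>) A *\<^sub>R y)"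
    using A' by (intro has_bochner_integral_scaleR_left has_bochner_integral_real_indicator) (auto simp: m.emeasure_eq_measure)
  have diff: "has_bochner_integral (m \<omega>) (\<lambda>x. indicator A x *\<^sub>R F x - indicator A x *\<^sub>R y) (V - measure (m \<omega>) A *\<^sub>R y)"
    by (rule has_bochner_integral_diff[OF F y])
  have "norm (V - measure (m \<omega>) A *\<^sub>R y) \<le> (\<integral>x. norm (indicator A x *\<^sub>R F x - indicator A x *\<^sub>R y) \<partial>m \<omega>)"
    using integral_norm_bound[of "m \<omega>" "\<lambda>x. indicator A x *\<^sub>R F x - indicator A x *\<^sub>R y"]
    by (simp add: has_bochner_integral_integral_eq[OF diff])
  also have "\<dots> \<le> (\<integral>x. \<epsilon> * indicator A x \<partial>m \<omega>)"
  proof (rule integral_mono)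
    show "integrable (m \<omega>) (\<lambda>x. norm (indicator A x *\<^sub>R F x - indicator A x *\<^sub>R y))"
      using diff by (intro integrable_norm) (auto simp: has_bochner_integral_iff)
    show "integrable (m \<omega>) (\<lambda>x. \<epsilon> * indicator A x)"
      using A' by (auto simp: m.emeasure_eq_measure)
    show "norm (indicator A x *\<^sub>R F x - indicator A x *\<^sub>R y) \<le> \<epsilon> * indicator A x" for x
      using near[of x] by (auto simp: F_def indicator_def dist_norm norm_minus_commute)
  qed
  also have "\<dots> = \<epsilon> * measure (m \<omega>) A" using A' by simp
  finally have le: "norm (V - measure (m \<omega>) A *\<^sub>R y) \<le> \<epsilon> * measure (m \<omega>) A" .
  have "V /\<^sub>R measure (m \<omega>) A - y = (V - measure (m \<omega>) A *\<^sub>R y) /\<^sub>R measure (m \<omega>) A"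
    using A_pos by (simp add: scaleR_diff_right)
  also have "norm \<dots> \<le> \<epsilon>"
  proof -
    have "norm (W /\<^sub>R w) \<le> \<epsilon>" if "0 < w" "norm W \<le> \<epsilon> * w" for W :: "(real^'d) \<times> real" and w
      using that by (simp add: field_simps)
    then show ?thesis using A_pos le .
  qed
  finally show ?thesis by (simp add: V_def[symmetric] dist_norm norm_minus_commute)
qed

text \<open>
  The argument described at the beginning, for closed null sets.  The parameter \<open>u\<close> ranges over the
  positive orthant \<open>U\<close> of \<open>\<real>\<^sup>d \<times> \<real>\<close>, and its coordinates are indexed by the same basis as the frame in
  the support.
\<close>
proposition AE_mean_notin_closed_null:
  fixes f :: "'d::finite \<Rightarrow> 'a \<Rightarrow> real" and S :: "(real^'d) set"
  assumes f [measurable]: "\<And>k. f k \<in> borel_measurable \<alpha>"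
    and int: "AE \<omega> in P. \<forall>k. integrable (m \<omega>) (f k)"
    and nondeg: "\<not> affinely_degenerate \<alpha> f"
    and S: "closed S" "negligible S"
  shows "AE \<omega> in P. (\<chi> k. \<integral>x. f k x \<partial>m \<omega>) \<notin> S"
proof -
  define F where "F x = (\<chi> k. f k x, 1 :: real)" for x
  have F [measurable]: "F \<in> borel_measurable \<alpha>" unfolding F_def borel_prod[symmetric] by measurable
  have "\<not> (AE x in \<alpha>. v \<bullet> F x = 0)" if "v \<noteq> 0" for v
    unfolding F_def using finite_measure_\<alpha> total_pos f nondeg that by (rule affinely_nondegenerateD)
  from stable_frame_in_support[OF finite_measure_\<alpha> F this]
  obtain x :: "(real^'d) \<times> real \<Rightarrow> (real^'d) \<times> real" and \<epsilon> :: real where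
    x_pos: "\<And>b. b \<in> Basis \<Longrightarrow> 0 < measure \<alpha> (F -` cball (x b) \<epsilon> \<inter> space \<alpha>)"
    and x_disj: "\<And>b b'. b \<in> Basis \<Longrightarrow> b' \<in> Basis \<Longrightarrow> b \<noteq> b' \<Longrightarrow> cball (x b) \<epsilon> \<inter> cball (x b') \<epsilon> = {}"
    and x_inj: "\<And>y w. (\<And>b. b \<in> Basis \<Longrightarrow> y b \<in> cball (x b) \<epsilon>) \<Longrightarrow> (\<And>b. b \<in> Basis \<Longrightarrow> 0 < (w b :: real)) \<Longrightarrow>
       inj (frame_map (\<lambda>b. w b *\<^sub>R y b))"
    by blast
  define A where "A b = F -` cball (x b) \<epsilon> \<inter> space \<alpha>" for b
  have A [measurable]: "A b \<in> sets \<alpha>" for b unfolding A_def by measurable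
  define U where "U = {u :: (real^'d) \<times> real. \<forall>b\<in>Basis. 0 < u \<bullet> b}"
  (* Since the sets A b are disjoint, this is u \<bullet> b on A b and 1 outside all of them. *)
  define c where "c u z = 1 + (\<Sum>b\<in>Basis. (u \<bullet> b - 1) * indicator (A b) z)" for u :: "(real^'d) \<times> real" and z
  have c_simple: "simple_function \<alpha> (c u)" for u
    unfolding c_def by (intro simple_function_add simple_function_sum simple_function_mult simple_function_const simple_function_indicator A)
  have c_pos: "0 < c u z" if u: "u \<in> U" for u z
  proof (cases "\<exists>b\<in>Basis. z \<in> A b")
    case True
    then obtain b where b: "b \<in> Basis" "z \<in> A b" by auto
    have "(\<Sum>b'\<in>Basis. (u \<bullet> b' - 1) * indicator (A b') z) = (\<Sum>b'\<in>Basis. if b' = b then u \<bullet> b - 1 else 0)"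
    proof (rule sum.cong)
      fix b' :: "(real^'d) \<times> real" assume b': "b' \<in> Basis"
      have "z \<notin> A b'" if "b' \<noteq> b"
        using x_disj[OF b(1) b'] b(2) that unfolding A_def by blast
      then show "(u \<bullet> b' - 1) * indicator (A b') z = (if b' = b then u \<bullet> b - 1 else 0)"
        using b(2) by simp
    qed simp
    then show ?thesis using b u by (simp add: c_def U_def)
  next
    case False
    then have "(\<Sum>b\<in>Basis. (u \<bullet> b - 1) * indicator (A b) z) = 0" by (intro sum.neutral) auto
    then show ?thesis by (simp add: c_def)
  qed
  (* On good events, mass and mom are the integrals of c u and of c u * f k; in this form they are
     jointly measurable in u and \<omega> and visibly affine in u. *)
  define mass where "mass u \<omega> = 1 + (\<Sum>b\<in>Basis. (u \<bullet> b - 1) * measure (m \<omega>) (A b))" for u \<omega>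
  define mom where "mom u \<omega> = (\<chi> k. (\<integral>x. f k x \<partial>m \<omega>) + (\<Sum>b\<in>Basis. (u \<bullet> b - 1) * (\<integral>x. indicator (A b) x * f k x \<partial>m \<omega>)))" for u \<omega>
  define good where "good \<omega> \<longleftrightarrow> \<omega> \<in> space P \<and> (\<forall>k. integrable (m \<omega>) (f k)) \<and> (\<forall>b\<in>Basis. 0 < measure (m \<omega>) (A b))" for \<omega>
  have good: "AE \<omega> in P. good \<omega>"
  proof -
    have "AE \<omega> in P. \<forall>b\<in>Basis. 0 < measure (m \<omega>) (A b)"
      using x_pos by (subst AE_ball_countable) (auto intro!: AE_m_pos simp: A_def[symmetric] countable_finite)
    then show ?thesis using int AE_space[of P] unfolding good_def by eventually_elim auto
  qed
  have c_int: "has_bochner_integral (m \<omega>) (c u) (mass u \<omega>)" if \<omega>: "\<omega> \<in> space P" for u \<omega>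
  proof -
    interpret m: prob_space "m \<omega>" by (rule prob_space_m[OF \<omega>])
    have "has_bochner_integral (m \<omega>) (\<lambda>_. 1 :: real) 1"
      by (simp add: has_bochner_integral_iff m.prob_space)
    then show ?thesis
      unfolding c_def[abs_def] mass_def
      by (intro has_bochner_integral_add has_bochner_integral_sum has_bochner_integral_mult_right
          has_bochner_integral_real_indicator) (auto simp: sets_m[OF \<omega>] m.emeasure_eq_measure)
  qed
  have mass_eq: "(\<integral>z. c u z \<partial>m \<omega>) = mass u \<omega>" and mom_eq: "(\<integral>z. c u z * f k z \<partial>m \<omega>) = mom u \<omega> $ k"
    if "good \<omega>" for u \<omega> k
  proof -
    have \<omega>: "\<omega> \<in> space P" and fi: "integrable (m \<omega>) (f k)" using that by (auto simp: good_def)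
    interpret m: prob_space "m \<omega>" by (rule prob_space_m[OF \<omega>])
    have A': "A b \<in> sets (m \<omega>)" for b by (simp add: sets_m[OF \<omega>])
    show "(\<integral>z. c u z \<partial>m \<omega>) = mass u \<omega>"
      using c_int[OF \<omega>] by (rule has_bochner_integral_integral_eq)
    have ind: "integrable (m \<omega>) (\<lambda>z. indicator (A b) z * f k z)" for b
      using integrable_mult_indicator[OF A' fi] by simp
    have "(\<integral>z. c u z * f k z \<partial>m \<omega>) = (\<integral>z. f k z + (\<Sum>b\<in>Basis. (u \<bullet> b - 1) * (indicator (A b) z * f k z)) \<partial>m \<omega>)"
      by (intro Bochner_Integration.integral_cong) (simp_all only: c_def distrib_right sum_distrib_right mult.assoc mult_1)
    also have "\<dots> = mom u \<omega> $ k"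
      using fi ind by (simp add: mom_def)
    finally show "(\<integral>z. c u z * f k z \<partial>m \<omega>) = mom u \<omega> $ k" .
  qed
  have negl: "negligible {u \<in> U. mom u \<omega> /\<^sub>R mass u \<omega> \<in> S}" if g: "good \<omega>" for \<omega>
  proof -
    have \<omega>: "\<omega> \<in> space P" using g by (simp add: good_def)
    interpret m: prob_space "m \<omega>" by (rule prob_space_m[OF \<omega>])
    define V where "V b = (\<chi> k. \<integral>x. indicator (A b) x * f k x \<partial>m \<omega>, measure (m \<omega>) (A b))" for b
    define w where "w b = measure (m \<omega>) (A b)" for b
    define r where "r = (\<chi> k. \<integral>x. f k x \<partial>m \<omega>, 1) - (\<Sum>b\<in>Basis. V b)"
    have w: "0 < w b" if "b \<in> Basis" for b using g that by (auto simp: good_def w_def)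
    have "inj (frame_map (\<lambda>b. w b *\<^sub>R (V b /\<^sub>R w b)))"
    proof (rule x_inj)
      show "V b /\<^sub>R w b \<in> cball (x b) \<epsilon>" if "b \<in> Basis" for b
        unfolding V_def w_def using g that
        by (intro cell_average_in_cball) (auto simp: good_def A_def F_def)
    qed (rule w)
    moreover have "frame_map (\<lambda>b. w b *\<^sub>R (V b /\<^sub>R w b)) = frame_map V"
      unfolding frame_map_def using w by (intro ext sum.cong) (auto simp: less_le)
    ultimately have "inj (frame_map V)" by simp
    then have neg: "negligible {u. frame_map V u + r \<in> {z. snd z \<noteq> 0 \<and> fst z /\<^sub>R snd z \<in> S}}"
      by (intro negligible_affine_preimage linear_frame_map negligible_cone S)
    have lin: "frame_map V u + r = (mom u \<omega>, mass u \<omega>)" for u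
    proof -
      have "frame_map V u + r = (\<chi> k. \<integral>x. f k x \<partial>m \<omega>, 1) + (\<Sum>b\<in>Basis. (u \<bullet> b - 1) *\<^sub>R V b)"
        by (simp add: frame_map_def r_def scaleR_diff_left sum_subtractf)
      also have "\<dots> = (mom u \<omega>, mass u \<omega>)"
        by (auto simp: prod_eq_iff vec_eq_iff fst_sum snd_sum mom_def mass_def V_def)
      finally show ?thesis .
    qed
    have "mass u \<omega> \<noteq> 0" if "u \<in> U" for u
    proof -
      have int_c: "integrable (m \<omega>) (c u)"
        using c_int[OF \<omega>] by (simp add: has_bochner_integral_iff)
      have "0 < (\<integral>z. c u z \<partial>m \<omega>)"
        using c_pos[OF that] int_c by (intro m.expectation_greater) auto
      then show ?thesis by (simp add: mass_eq[OF g])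
    qed
    then show ?thesis
      by (intro negligible_subset[OF neg]) (auto simp: lin)
  qed
  have S_meas [measurable]: "S \<in> sets borel" using S by simp
  have U_meas [measurable]: "U \<in> sets borel" unfolding U_def by measurable
  have meas1 [measurable]: "(\<lambda>\<omega>. measure (m \<omega>) (A b)) \<in> borel_measurable P" for b by (rule measurable_measure_m[OF A])
  have meas2 [measurable]: "(\<lambda>\<omega>. \<integral>x. f k x \<partial>m \<omega>) \<in> borel_measurable P" for k by (rule measurable_integral_m[OF f])
  have meas3 [measurable]: "(\<lambda>\<omega>. \<integral>x. indicator (A b) x * f k x \<partial>m \<omega>) \<in> borel_measurable P" for k b
    by (rule measurable_integral_m) measurable
  interpret PL: pair_sigma_finite P "lborel :: ((real^'d) \<times> real) measure" ..
  have joint: "{z \<in> space (P \<Otimes>\<^sub>M lborel). \<not> (snd z \<in> U \<and> mom (snd z) (fst z) /\<^sub>R mass (snd z) (fst z) \<in> S)} \<in> sets (P \<Otimes>\<^sub>M lborel)"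
    unfolding mom_def mass_def by measurable
  have "AE \<omega> in P. AE u in lborel. \<not> (u \<in> U \<and> mom u \<omega> /\<^sub>R mass u \<omega> \<in> S)"
    using good
  proof eventually_elim
    fix \<omega> assume g: "good \<omega>"
    have "{u \<in> U. mom u \<omega> /\<^sub>R mass u \<omega> \<in> S} \<in> sets borel"
      unfolding mom_def mass_def by measurable
    then have "{u \<in> U. mom u \<omega> /\<^sub>R mass u \<omega> \<in> S} \<in> null_sets lborel"
      using negl[OF g] by (simp add: negligible_iff_null_sets null_sets_completion_iff)
    from AE_not_in[OF this] show "AE u in lborel. \<not> (u \<in> U \<and> mom u \<omega> /\<^sub>R mass u \<omega> \<in> S)" by simp
  qed
  then have ae_u: "AE u in lborel. AE \<omega> in P. \<not> (u \<in> U \<and> mom u \<omega> /\<^sub>R mass u \<omega> \<in> S)"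
    by (subst (asm) PL.AE_commute[OF joint])
  obtain u where u: "u \<in> U" "AE \<omega> in P. \<not> (u \<in> U \<and> mom u \<omega> /\<^sub>R mass u \<omega> \<in> S)"
  proof (rule ccontr)
    assume "\<not> thesis"
    with that have no: "\<not> (AE \<omega> in P. \<not> (u \<in> U \<and> mom u \<omega> /\<^sub>R mass u \<omega> \<in> S))" if "u \<in> U" for u using that by blast
    from ae_u have "AE u in lborel. u \<notin> U" by eventually_elim (use no in blast)
    then have "U \<in> null_sets lborel" by (subst (asm) AE_iff_null_sets[symmetric]) auto
    then have "negligible U" by (simp add: negligible_iff_null_sets null_sets_completionI)
    moreover have "open U"
    proof -
      have "U = (\<Inter>b\<in>Basis. {u. 0 < u \<bullet> b})" by (auto simp: U_def)
      then show ?thesis by (auto intro!: open_INT open_Collect_less continuous_intros)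
    qed
    moreover have "One \<in> U" by (simp add: U_def)
    ultimately show False using open_not_negligible by blast
  qed
  have "(\<integral>\<^sup>+\<omega>. indicator S (\<chi> k. (\<integral>z. c u z * f k z \<partial>m \<omega>) / (\<integral>z. c u z \<partial>m \<omega>)) *
        ennreal ((\<integral>z. c u z \<partial>m \<omega>) powr (- total)) \<partial>P) = (\<integral>\<^sup>+\<omega>. 0 \<partial>P)"
    using good u(2)
  proof (intro nn_integral_cong_AE, eventually_elim)
    fix \<omega> assume g: "good \<omega>" and n: "\<not> (u \<in> U \<and> mom u \<omega> /\<^sub>R mass u \<omega> \<in> S)"
    have "(\<chi> k. (\<integral>z. c u z * f k z \<partial>m \<omega>) / (\<integral>z. c u z \<partial>m \<omega>)) = mom u \<omega> /\<^sub>R mass u \<omega>"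
      by (simp add: vec_eq_iff mass_eq[OF g] mom_eq[OF g] divide_inverse mult.commute)
    then show "indicator S (\<chi> k. (\<integral>z. c u z * f k z \<partial>m \<omega>) / (\<integral>z. c u z \<partial>m \<omega>)) *
        ennreal ((\<integral>z. c u z \<partial>m \<omega>) powr (- total)) = 0"
      using n u(1) by simp
  qed
  then have "ennreal (exp (- (\<integral>z. ln (c u z) \<partial>\<alpha>))) * (\<integral>\<^sup>+\<omega>. indicator S (\<chi> k. \<integral>x. f k x \<partial>m \<omega>) \<partial>P) = 0"
    using quasi_invariant_closed[OF f int c_simple c_pos[OF u(1)] S(1)] by simp
  then have "(\<integral>\<^sup>+\<omega>. indicator S (\<chi> k. \<integral>x. f k x \<partial>m \<omega>) \<partial>P) = 0"
    by simp
  moreover have "(\<lambda>\<omega>. indicator S (\<chi> k. \<integral>x. f k x \<partial>m \<omega>) :: ennreal) \<in> borel_measurable P"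
    by measurable
  ultimately have "AE \<omega> in P. indicator S (\<chi> k. \<integral>x. f k x \<partial>m \<omega>) = (0 :: ennreal)"
    by (simp add: nn_integral_0_iff_AE)
  then show ?thesis by (rule AE_mp) (auto intro!: AE_I2 simp: indicator_def split: if_splits)
qed

end

theorem theorem10:
  fixes \<alpha> :: "'a measure"
    and f :: "'d::finite \<Rightarrow> 'a \<Rightarrow> real"
    and P :: "'w measure"
    and m :: "'w \<Rightarrow> 'a measure"
  assumes "finite_measure \<alpha>"
    and "0 < measure \<alpha> (space \<alpha>)"
    and "\<And>k. f k \<in> borel_measurable \<alpha>"
    and "\<And>k. integrable \<alpha> (\<lambda>x. ln (1 + \<bar>f k x\<bar>))"
    and "\<not> affinely_degenerate \<alpha> f"
    and "prob_space P"
    and "functional_dirichlet P \<alpha> m"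
  shows "absolutely_continuous lborel (mean_distr P m f)"
proof -
  interpret dirichlet_random_measure \<alpha> P m
    using assms by (intro dirichlet_random_measure.intro)
  have Y: "(\<lambda>\<omega>. \<chi> k. \<integral>x. f k x \<partial>m \<omega>) \<in> borel_measurable P"
    using assms(3) kernel by (rule measurable_mean)
  interpret mean: prob_space "mean_distr P m f"
    unfolding mean_distr_def by (rule P.prob_space_distr[OF Y])
  have int: "AE \<omega> in P. \<forall>k. integrable (m \<omega>) (f k)"
    using AE_integrable_m[OF assms(3,4)] by (simp add: AE_all_countable)
  have sets: "sets (mean_distr P m f) = sets borel" by (simp add: mean_distr_def)
  show ?thesis
    unfolding absolutely_continuous_def
  proof
    fix N :: "(real^'d) set" assume N: "N \<in> null_sets lborel"
    (* By inner regularity it is enough to treat compact null sets, which are closed. *)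
    have "emeasure (mean_distr P m f) K = 0" if K: "K \<subseteq> N" "compact K" for K
    proof -
      have "closed K" "negligible K"
        using K N by (auto simp: compact_imp_closed negligible_iff_null_sets[of N] null_sets_completionI
            intro: negligible_subset[of N])
      then have ae: "AE \<omega> in P. (\<chi> k. \<integral>x. f k x \<partial>m \<omega>) \<notin> K"
        using AE_mean_notin_closed_null[OF assms(3) int assms(5)] by blast
      have "AE y in mean_distr P m f. y \<notin> K"
        unfolding mean_distr_def using Y ae \<open>closed K\<close> by (subst AE_distr_iff) (auto simp: Collect_neg_eq)
      then have "K \<in> null_sets (mean_distr P m f)"
        using \<open>closed K\<close> by (subst AE_iff_null_sets) (auto simp: sets)
      then show ?thesis by auto
    qed
    then have "(SUP K\<in>{K. K \<subseteq> N \<and> compact K}. emeasure (mean_distr P m f) K) = 0"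
      by (auto simp: bot_ennreal[symmetric] SUP_eq_const intro!: SUP_bot_conv(1)[THEN iffD2])
    then have "emeasure (mean_distr P m f) N = 0"
      using inner_regular[OF sets, of N] N by (auto simp: mean.emeasure_finite)
    then show "N \<in> null_sets (mean_distr P m f)" using N by (auto simp: null_sets_def sets)
  qed
qed

end
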